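(* Let $(\mathcal{M},\tau)$ be a finite von Neumann algebra with a faithful normal tracial state $\tau$, and let $\eta(x)=x\log x$ for $x>0$, $\eta(0)=0$. For all positive elements $A,B\in\mathcal{M}_{+}$, $$J_{\tau,\eta}(A,B)=\int_0^\infty d_\tau(A+t\mathbf{1},B+t\mathbf{1})^2\,\mathrm{d}t .$$
   Context: $\mathcal{M}_{+}$ is the positive cone of $\mathcal{M}$ and $\mathcal{M}_{++}$ its set of invertible positive elements; $\tau(\mathbf{1})=1$. For $A,B\in\mathcal{M}_{+}$, $J_{\tau,\eta}(A,B):=\frac12\tau(\eta(A))+\frac12\tau(\eta(B))-\tau(\eta(\frac{A+B}{2}))$. For $A,B\in\mathcal{M}_{++}$, $d_\tau(A,B)\ge 0$ is defined by $d_\tau(A,B)^2:=\tau(\log\frac{A+B}{2})-\frac12\tau(\log A)-\frac12\tau(\log B)$. *)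

theory Defs
  imports "HOL-Analysis.Analysis" "HOL-Computational_Algebra.Polynomial"
begin

text \<open>The inner product \<open>cinner\<close> is linear in its first argument. Norm and topology are those of
  the underlying real inner product \<open>Re (cinner x y)\<close>; in particular positive definiteness is
  inherited from \<open>real_inner\<close>.\<close>

class chilbert_space = real_inner + complete_space +
  fixes scaleC :: "complex \<Rightarrow> 'a \<Rightarrow> 'a"
    and cinner :: "'a \<Rightarrow> 'a \<Rightarrow> complex"
  assumes scaleC_add_right: "scaleC c (x + y) = scaleC c x + scaleC c y"
    and scaleC_add_left: "scaleC (c + d) x = scaleC c x + scaleC d x"
    and scaleC_scaleC: "scaleC c (scaleC d x) = scaleC (c * d) x"
    and scaleC_of_real: "scaleC (complex_of_real r) x = r *\<^sub>R x"
    and cinner_add_left: "cinner (x + y) z = cinner x z + cinner y z"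
    and cinner_scaleC_left: "cinner (scaleC c x) y = c * cinner x y"
    and cinner_commute: "cinner x y = cnj (cinner y x)"
    and inner_eq_Re_cinner: "inner x y = Re (cinner x y)"

text \<open>The library type of bounded linear maps is real-linear, so $B(H)$ is the subset of
  complex-linear ones; its norm is the operator norm.\<close>

definition bounded_ops :: "('h::chilbert_space \<Rightarrow>\<^sub>L 'h) set" where
  "bounded_ops = {T. \<forall>c x. blinfun_apply T (scaleC c x) = scaleC c (blinfun_apply T x)}"

definition scaleC_op :: "complex \<Rightarrow> ('h::chilbert_space \<Rightarrow>\<^sub>L 'h) \<Rightarrow> ('h \<Rightarrow>\<^sub>L 'h)" where
  "scaleC_op c T = Blinfun (\<lambda>x. scaleC c (blinfun_apply T x))"

definition is_adjoint :: "('h::chilbert_space \<Rightarrow>\<^sub>L 'h) \<Rightarrow> ('h \<Rightarrow>\<^sub>L 'h) \<Rightarrow> bool" where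
  "is_adjoint S T \<longleftrightarrow>
     (\<forall>x y. cinner (blinfun_apply S x) y = cinner x (blinfun_apply T y))"

definition positive_op :: "('h::chilbert_space \<Rightarrow>\<^sub>L 'h) \<Rightarrow> bool" where
  "positive_op T \<longleftrightarrow> T \<in> bounded_ops \<and> (\<forall>x. cinner (blinfun_apply T x) x \<in> \<real>\<^sub>\<ge>\<^sub>0)"

definition op_le :: "('h::chilbert_space \<Rightarrow>\<^sub>L 'h) \<Rightarrow> ('h \<Rightarrow>\<^sub>L 'h) \<Rightarrow> bool" where
  "op_le S T \<longleftrightarrow> positive_op (T - S)"

definition op_spectrum :: "('h::chilbert_space \<Rightarrow>\<^sub>L 'h) \<Rightarrow> complex set" where
  "op_spectrum T = {z. \<not> (\<exists>S\<in>bounded_ops.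
      S o\<^sub>L (T - scaleC_op z id_blinfun) = id_blinfun \<and>
      (T - scaleC_op z id_blinfun) o\<^sub>L S = id_blinfun)}"

definition poly_op :: "real poly \<Rightarrow> ('h::chilbert_space \<Rightarrow>\<^sub>L 'h) \<Rightarrow> ('h \<Rightarrow>\<^sub>L 'h)" where
  "poly_op p T = (\<Sum>i\<le>degree p. coeff p i *\<^sub>R (((o\<^sub>L) T ^^ i) id_blinfun))"

text \<open>Continuous functional calculus $f(T)$, for $T$ self-adjoint (so that its spectrum is real)
  and $f$ real-valued and continuous on the spectrum of $T$: the norm limit of $p_n(T)$ for
  polynomials $p_n$ converging to $f$ uniformly on the spectrum. No meaning is attached to it for
  other arguments.\<close>

definition cfc :: "(real \<Rightarrow> real) \<Rightarrow> ('h::chilbert_space \<Rightarrow>\<^sub>L 'h) \<Rightarrow> ('h \<Rightarrow>\<^sub>L 'h)" where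
  "cfc f T = (THE S. \<forall>p :: nat \<Rightarrow> real poly.
      uniform_limit {x. complex_of_real x \<in> op_spectrum T} (\<lambda>n. poly (p n)) f sequentially
      \<longrightarrow> (\<lambda>n. poly_op (p n) T) \<longlonglongrightarrow> S)"

definition commutant :: "('h::chilbert_space \<Rightarrow>\<^sub>L 'h) set \<Rightarrow> ('h \<Rightarrow>\<^sub>L 'h) set" where
  "commutant N = {T \<in> bounded_ops. \<forall>S\<in>N. T o\<^sub>L S = S o\<^sub>L T}"

text \<open>$M = M''$ already makes $M$ a unital complex subalgebra of $B(H)$.\<close>

definition von_neumann_algebra :: "('h::chilbert_space \<Rightarrow>\<^sub>L 'h) set \<Rightarrow> bool" where
  "von_neumann_algebra M \<longleftrightarrow>
     (\<forall>T\<in>M. \<exists>S\<in>M. is_adjoint S T) \<and> commutant (commutant M) = M"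

text \<open>Finiteness: every isometry in $M$ is unitary.\<close>

definition finite_von_neumann_algebra :: "('h::chilbert_space \<Rightarrow>\<^sub>L 'h) set \<Rightarrow> bool" where
  "finite_von_neumann_algebra M \<longleftrightarrow> von_neumann_algebra M \<and>
     (\<forall>V\<in>M. \<forall>W\<in>M. is_adjoint W V \<and> W o\<^sub>L V = id_blinfun \<longrightarrow> V o\<^sub>L W = id_blinfun)"

definition pos_cone :: "('h::chilbert_space \<Rightarrow>\<^sub>L 'h) set \<Rightarrow> ('h \<Rightarrow>\<^sub>L 'h) set" where
  "pos_cone M = {A \<in> M. positive_op A}"

definition state_on ::
  "('h::chilbert_space \<Rightarrow>\<^sub>L 'h) set \<Rightarrow> (('h \<Rightarrow>\<^sub>L 'h) \<Rightarrow> complex) \<Rightarrow> bool" where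
  "state_on M \<tau> \<longleftrightarrow>
     (\<forall>A\<in>M. \<forall>B\<in>M. \<tau> (A + B) = \<tau> A + \<tau> B) \<and>
     (\<forall>c. \<forall>A\<in>M. \<tau> (scaleC_op c A) = c * \<tau> A) \<and>
     (\<forall>A\<in>pos_cone M. \<tau> A \<in> \<real>\<^sub>\<ge>\<^sub>0) \<and>
     \<tau> id_blinfun = 1"

definition tracial_on ::
  "('h::chilbert_space \<Rightarrow>\<^sub>L 'h) set \<Rightarrow> (('h \<Rightarrow>\<^sub>L 'h) \<Rightarrow> complex) \<Rightarrow> bool" where
  "tracial_on M \<tau> \<longleftrightarrow> (\<forall>A\<in>M. \<forall>B\<in>M. \<tau> (A o\<^sub>L B) = \<tau> (B o\<^sub>L A))"

definition faithful_on ::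
  "('h::chilbert_space \<Rightarrow>\<^sub>L 'h) set \<Rightarrow> (('h \<Rightarrow>\<^sub>L 'h) \<Rightarrow> complex) \<Rightarrow> bool" where
  "faithful_on M \<tau> \<longleftrightarrow> (\<forall>A\<in>pos_cone M. \<tau> A = 0 \<longrightarrow> A = 0)"

text \<open>The conditions on \<open>S\<close> say that it is the least upper bound of the directed set \<open>D\<close> in the
  operator order of \<open>M\<close>; since \<open>D\<close> is nonempty and bounded by \<open>S\<close>, the real supremum is not a
  default value.\<close>

definition normal_on ::
  "('h::chilbert_space \<Rightarrow>\<^sub>L 'h) set \<Rightarrow> (('h \<Rightarrow>\<^sub>L 'h) \<Rightarrow> complex) \<Rightarrow> bool" where
  "normal_on M \<tau> \<longleftrightarrow> (\<forall>D S.
     D \<subseteq> pos_cone M \<and> D \<noteq> {} \<and>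
     (\<forall>A\<in>D. \<forall>B\<in>D. \<exists>C\<in>D. op_le A C \<and> op_le B C) \<and>
     S \<in> M \<and> (\<forall>A\<in>D. op_le A S) \<and> (\<forall>U\<in>M. (\<forall>A\<in>D. op_le A U) \<longrightarrow> op_le S U)
     \<longrightarrow> Re (\<tau> S) = (SUP A\<in>D. Re (\<tau> A)))"

definition eta :: "real \<Rightarrow> real" where
  "eta x = (if x = 0 then 0 else x * ln x)"

definition J_eta ::
  "(('h::chilbert_space \<Rightarrow>\<^sub>L 'h) \<Rightarrow> complex) \<Rightarrow> ('h \<Rightarrow>\<^sub>L 'h) \<Rightarrow> ('h \<Rightarrow>\<^sub>L 'h) \<Rightarrow> complex" where
  "J_eta \<tau> A B = 1/2 * \<tau> (cfc eta A) + 1/2 * \<tau> (cfc eta B)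
     - \<tau> (cfc eta ((1/2) *\<^sub>R (A + B)))"

text \<open>To be used only for invertible positive \<open>A\<close>, \<open>B\<close>: then \<open>ln\<close> is continuous on the spectra
  involved and the right-hand side is real and nonnegative.\<close>

definition d_tau ::
  "(('h::chilbert_space \<Rightarrow>\<^sub>L 'h) \<Rightarrow> complex) \<Rightarrow> ('h \<Rightarrow>\<^sub>L 'h) \<Rightarrow> ('h \<Rightarrow>\<^sub>L 'h) \<Rightarrow> real" where
  "d_tau \<tau> A B = (THE d. 0 \<le> d \<and> complex_of_real (d\<^sup>2) =
     \<tau> (cfc ln ((1/2) *\<^sub>R (A + B))) - 1/2 * \<tau> (cfc ln A) - 1/2 * \<tau> (cfc ln B))"

end

theory Submission
  imports Defs "HOL-Computational_Algebra.Fundamental_Theorem_Algebra" "HOL-Real_Asymp.Real_Asymp"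
begin

text \<open>For a positive operator \<open>C\<close>, \<open>f \<mapsto> \<tau>(f(C))\<close> is a linear functional on \<open>C([0, \<parallel>C\<parallel>])\<close> that is bounded
  in the supremum norm, so one may differentiate \<open>t \<mapsto> \<tau>(\<phi>(C + t))\<close> under it. Put \<open>Z = (A + B)/2\<close>
  and \<open>J(\<phi>) = \<tau>(\<phi>(Z)) - \<tau>(\<phi>(A))/2 - \<tau>(\<phi>(B))/2\<close>. The function \<open>h(t) = J(ln(\<cdot> + t))\<close> has derivative
  \<open>J(1/(\<cdot> + t)) \<le> 0\<close>, because the inverse is operator convex, and tends to \<open>0\<close> at infinity; hence
  \<open>h \<ge> 0\<close> and \<open>h(t) = d\<^sub>\<tau>(A + t, B + t)\<^sup>2\<close>. Since \<open>\<eta>' = ln + 1\<close> and \<open>J(1) = 0\<close>, the function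
  \<open>F(t) = J(\<eta>(\<cdot> + t))\<close> is a primitive of \<open>h\<close>. It tends to \<open>J(\<eta>)\<close> at \<open>0\<close>, and to \<open>0\<close> at infinity, because
  \<open>\<eta>(x + t) = t ln t + (ln t + 1) x + O(1/t)\<close> uniformly on bounded sets and \<open>J\<close> kills affine functions.
  Here \<open>J(\<eta>)\<close> is the negative of the Jensen gap in the theorem.\<close>

section \<open>Bounded operators and positivity\<close>

text \<open>The inverse may be any bounded real-linear map; complex linearity is recovered in
  \<open>real_spectrum_iff\<close>. This keeps the coercivity arguments free of complex
  scalars.\<close>

definition invertible_op :: "('a::real_normed_vector \<Rightarrow>\<^sub>L 'a) \<Rightarrow> bool" where
  "invertible_op T \<longleftrightarrow> (\<exists>S. S o\<^sub>L T = id_blinfun \<and> T o\<^sub>L S = id_blinfun)"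

lemma blinfun_compose_id [simp]:
  "T o\<^sub>L id_blinfun = T" "id_blinfun o\<^sub>L T = T"
  by (auto intro!: blinfun_eqI)

lemma blinfun_compose_assoc: "(S o\<^sub>L T) o\<^sub>L U = S o\<^sub>L (T o\<^sub>L U)"
  by (rule blinfun_eqI) simp

interpretation op_comp: bounded_bilinear "(o\<^sub>L)"
  by (rule bounded_bilinear_blinfun_compose)

lemma invertible_op_compose:
  assumes "invertible_op S" "invertible_op T"
  shows "invertible_op (S o\<^sub>L T)"
proof -
  obtain S' T' where "S' o\<^sub>L S = id_blinfun" "S o\<^sub>L S' = id_blinfun"
    "T' o\<^sub>L T = id_blinfun" "T o\<^sub>L T' = id_blinfun"
    using assms unfolding invertible_op_def by blast
  then have "(T' o\<^sub>L S') o\<^sub>L (S o\<^sub>L T) = id_blinfun" "(S o\<^sub>L T) o\<^sub>L (T' o\<^sub>L S') = id_blinfun"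
    by (metis blinfun_compose_assoc blinfun_compose_id(2))+
  then show ?thesis unfolding invertible_op_def by blast
qed

section \<open>Coercive operators are invertible\<close>

lemma coercive_norm_bound:
  fixes x :: "'a::real_inner"
  assumes "c * (norm x)\<^sup>2 \<le> y \<bullet> x"
  shows "c * norm x \<le> norm y"
proof (cases "x = 0")
  case False
  have "c * (norm x)\<^sup>2 \<le> norm y * norm x"
    using assms norm_cauchy_schwarz[of y x] by linarith
  then show ?thesis using False by (simp add: power2_eq_square)
qed simp

text \<open>The equation \<open>P x = y\<close> is solved by the fixed point of \<open>x \<mapsto> x - k (P x - y)\<close>, which for
  small \<open>k > 0\<close> is a contraction.\<close>

lemma lax_milgram:
  fixes P :: "'a::{real_inner, complete_space} \<Rightarrow>\<^sub>L 'a"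
  assumes c: "c > 0" and coercive: "\<And>x. c * (norm x)\<^sup>2 \<le> P x \<bullet> x"
  shows "invertible_op P"
proof -
  \<comment> \<open>Adding \<open>c\<close> to the norm makes \<open>b\<close> positive and at least
    \<open>c\<close>, so \<open>k * c = (c / b)\<^sup>2\<close> is at most \<open>1\<close> and the
    square root defining \<open>q\<close> is real. Since also
    \<open>k\<^sup>2 * b\<^sup>2 = k * c\<close>, the expansion below collapses to
    \<open>1 - k * c = q\<^sup>2\<close>.\<close>
  define b where "b = norm P + c"
  have b: "b > 0" "c \<le> b" "norm P \<le> b" using c by (auto simp: b_def add_nonneg_pos)
  define k where "k = c / b\<^sup>2"
  have k: "k > 0" using b c by (simp add: k_def)
  define q where "q = sqrt (1 - k * c)"
  have kc: "0 < k * c" "k * c \<le> 1"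
    using c b k by (auto simp: k_def power2_eq_square mult_mono)
  have q: "0 \<le> q" "q < 1" using kc by (auto simp: q_def)
  have contr: "norm (x - k *\<^sub>R P x) \<le> q * norm x" for x
  proof -
    have "(norm (P x))\<^sup>2 \<le> (b * norm x)\<^sup>2"
      using order_trans[OF norm_blinfun[of P x] mult_right_mono[OF b(3)]]
      by (intro power_mono) auto
    then have 1: "k\<^sup>2 * (norm (P x))\<^sup>2 \<le> k\<^sup>2 * (b\<^sup>2 * (norm x)\<^sup>2)"
      by (intro mult_left_mono) (auto simp: power_mult_distrib)
    have kb: "k\<^sup>2 * b\<^sup>2 = k * c" using b by (simp add: k_def power2_eq_square)
    have 2: "2 * k * (c * (norm x)\<^sup>2) \<le> 2 * k * (P x \<bullet> x)"
      using coercive[of x] k by (intro mult_left_mono) auto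
    have "(norm (x - k *\<^sub>R P x))\<^sup>2 = (norm x)\<^sup>2 - 2 * k * (P x \<bullet> x) + k\<^sup>2 * (norm (P x))\<^sup>2"
      unfolding power2_norm_eq_inner
      by (simp add: inner_diff inner_commute[of x "P x"] power2_eq_square algebra_simps)
    also have "\<dots> \<le> (norm x)\<^sup>2 - 2 * k * (c * (norm x)\<^sup>2) + k\<^sup>2 * b\<^sup>2 * (norm x)\<^sup>2"
      using 1 2 by (simp add: mult.assoc)
    also have "\<dots> = (q * norm x)\<^sup>2"
      using kc unfolding kb by (simp add: q_def power_mult_distrib algebra_simps)
    finally show ?thesis by (rule power2_le_imp_le) (use q in simp)
  qed
  have inj: "x = y" if "P x = P y" for x y
    using coercive_norm_bound[OF coercive[of "x - y"]] that c
    by (simp add: blinfun.bilinear_simps zero_compare_simps)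
  have surj: "\<exists>x. P x = y" for y
  proof -
    have "\<exists>!x\<in>UNIV. x - k *\<^sub>R (P x - y) = x"
    proof (rule Banach_fix[where c = q])
      show "complete (UNIV :: 'a set)" by (rule complete_UNIV)
      show "dist (x - k *\<^sub>R (P x - y)) (z - k *\<^sub>R (P z - y)) \<le> q * dist x z" for x z
        using contr[of "x - z"]
        by (simp add: dist_norm blinfun.bilinear_simps algebra_simps)
    qed (use q in auto)
    then show ?thesis using k by auto
  qed
  \<comment> \<open>Bijectivity gives a set-theoretic inverse; linearity follows from injectivity of
    \<open>P\<close>, and coercivity bounds it by \<open>1 / c\<close>.\<close>
  define R where "R = (\<lambda>y. SOME x. P x = y)"
  have PR: "P (R y) = y" for y unfolding R_def using surj by (rule someI_ex)
  have RP: "R (P x) = x" for x using PR inj by blast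
  have bl: "bounded_linear R"
  proof (rule bounded_linear_intro[where K = "1 / c"])
    show "R (x + y) = R x + R y" for x y
      by (rule inj) (simp add: PR blinfun.bilinear_simps)
    show "R (r *\<^sub>R x) = r *\<^sub>R R x" for r x
      by (rule inj) (simp add: PR blinfun.bilinear_simps)
    show "norm (R x) \<le> norm x * (1 / c)" for x
      using coercive_norm_bound[OF coercive[of "R x"]] c by (simp add: PR field_simps)
  qed
  have "Blinfun R o\<^sub>L P = id_blinfun" "P o\<^sub>L Blinfun R = id_blinfun"
    by (auto intro!: blinfun_eqI simp: bounded_linear_Blinfun_apply[OF bl] PR RP)
  then show ?thesis unfolding invertible_op_def by blast
qed

section \<open>Complex scalars and Hermitian operators\<close>

lemma scaleC_scaleR: "scaleC c (r *\<^sub>R x) = r *\<^sub>R scaleC c (x::'h::chilbert_space)"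
  using scaleC_scaleC[of c "complex_of_real r" x] scaleC_scaleC[of "complex_of_real r" c x]
  by (simp add: mult.commute scaleC_of_real)

lemma scaleC_minus_right: "scaleC c (- x) = - scaleC c (x::'h::chilbert_space)"
  using scaleC_scaleR[of c "-1" x] by simp

lemma scaleC_diff_right:
  "scaleC c (x - y) = scaleC c x - scaleC c (y::'h::chilbert_space)"
  using scaleC_add_right[of c x "- y"] by (simp add: scaleC_minus_right)

lemma scaleC_zero_right: "scaleC c 0 = (0::'h::chilbert_space)"
  using scaleC_add_right[of c 0 0] by simp

lemma cinner_scaleC_right: "cinner x (scaleC c y) = cnj c * cinner (x::'h::chilbert_space) y"
  by (metis cinner_commute cinner_scaleC_left complex_cnj_mult)

lemma cinner_add_right: "cinner x (y + z) = cinner x y + cinner (x::'h::chilbert_space) z"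
  by (metis cinner_commute cinner_add_left complex_cnj_add)

lemma Re_complex_of_real_mult: "Re (complex_of_real r * z) = r * Re z"
  by simp

lemma norm_scaleC: "norm (scaleC c x) = cmod c * norm (x::'h::chilbert_space)"
proof (rule power2_eq_imp_eq)
  have "(norm (scaleC c x))\<^sup>2 = Re (c * cnj c * cinner x x)"
    by (simp add: power2_norm_eq_inner inner_eq_Re_cinner cinner_scaleC_left cinner_scaleC_right
        algebra_simps)
  also have "\<dots> = (cmod c)\<^sup>2 * (norm x)\<^sup>2"
    unfolding complex_norm_square[symmetric] Re_complex_of_real_mult
    by (simp add: power2_norm_eq_inner[of x] inner_eq_Re_cinner)
  finally show "(norm (scaleC c x))\<^sup>2 = (cmod c * norm x)\<^sup>2"
    by (simp add: power_mult_distrib)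
qed auto

lemma bounded_linear_scaleC: "bounded_linear (scaleC c :: 'h::chilbert_space \<Rightarrow> 'h)"
  by (rule bounded_linear_intro[where K = "cmod c"])
    (simp_all add: scaleC_add_right scaleC_scaleR norm_scaleC)

lemma scaleC_op_of_real [simp]: "scaleC_op (complex_of_real r) T = r *\<^sub>R T"
proof -
  have "(\<lambda>x. scaleC (complex_of_real r) (blinfun_apply T x)) = blinfun_apply (r *\<^sub>R T)"
    by (simp add: fun_eq_iff scaleC_of_real blinfun.bilinear_simps)
  then show ?thesis by (simp add: scaleC_op_def blinfun_apply_inverse)
qed

lemma bounded_ops_closure:
  "id_blinfun \<in> bounded_ops" "0 \<in> bounded_ops"
  "S \<in> bounded_ops \<Longrightarrow> T \<in> bounded_ops \<Longrightarrow> S + T \<in> bounded_ops"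
  "S \<in> bounded_ops \<Longrightarrow> T \<in> bounded_ops \<Longrightarrow> S - T \<in> bounded_ops"
  "S \<in> bounded_ops \<Longrightarrow> T \<in> bounded_ops \<Longrightarrow> S o\<^sub>L T \<in> bounded_ops"
  "S \<in> bounded_ops \<Longrightarrow> r *\<^sub>R S \<in> bounded_ops"
  by (auto simp: bounded_ops_def blinfun.bilinear_simps scaleC_add_right scaleC_diff_right
      scaleC_scaleR scaleC_zero_right)

text \<open>Symmetry for the real inner product suffices: for complex-linear \<open>T\<close>,
  replacing \<open>x\<close> by \<open>\<i> x\<close> yields the imaginary part of the complex
  identity.\<close>

definition hermitian :: "('h::chilbert_space \<Rightarrow>\<^sub>L 'h) \<Rightarrow> bool" where
  "hermitian T \<longleftrightarrow> T \<in> bounded_ops \<and> (\<forall>x y. T x \<bullet> y = x \<bullet> T y)"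

lemma hermitian_bounded_ops: "hermitian T \<Longrightarrow> T \<in> bounded_ops"
  by (simp add: hermitian_def)

lemma hermitian_inner: "hermitian T \<Longrightarrow> T x \<bullet> y = x \<bullet> T y"
  by (simp add: hermitian_def)

lemma hermitian_intros:
  "hermitian id_blinfun" "hermitian 0"
  "hermitian S \<Longrightarrow> hermitian T \<Longrightarrow> hermitian (S + T)"
  "hermitian S \<Longrightarrow> hermitian T \<Longrightarrow> hermitian (S - T)"
  "hermitian S \<Longrightarrow> hermitian (r *\<^sub>R S)"
  by (auto simp: hermitian_def bounded_ops_closure blinfun.bilinear_simps inner_add inner_diff)

text \<open>Testing symmetry on \<open>x\<close> and \<open>\<i> x\<close> equates the imaginary
  part with its own negative.\<close>

lemma hermitian_cinner_real:
  assumes "hermitian T"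
  shows "Im (cinner (blinfun_apply T x) x) = 0"
proof -
  have "T x \<bullet> scaleC \<i> x = x \<bullet> T (scaleC \<i> x)" using assms by (rule hermitian_inner)
  also have "T (scaleC \<i> x) = scaleC \<i> (T x)"
    using assms by (simp add: hermitian_def bounded_ops_def)
  finally show ?thesis
    by (simp add: inner_eq_Re_cinner cinner_scaleC_right cinner_commute[of x "T x"])
qed

text \<open>Complex polarization, applied to \<open>x + y\<close> and \<open>x + \<i> y\<close>.\<close>

lemma positive_op_iff:
  "positive_op T \<longleftrightarrow> hermitian T \<and> (\<forall>x. 0 \<le> T x \<bullet> x)"
proof
  assume T: "positive_op T"
  have lin: "T (scaleC c x) = scaleC c (T x)" for c x
    using T by (simp add: positive_op_def bounded_ops_def)
  have Im0: "Im (cinner (T x) x) = 0" for x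
    using T by (auto simp: positive_op_def complex_nonneg_Reals_iff)
  have "T x \<bullet> y = x \<bullet> T y" for x y
    using Im0[of "x + scaleC \<i> y"] Im0[of x] Im0[of y]
    by (simp add: blinfun.bilinear_simps lin cinner_add_left cinner_add_right cinner_scaleC_left
        cinner_scaleC_right inner_eq_Re_cinner cinner_commute[of x "T y"] algebra_simps)
  then show "hermitian T \<and> (\<forall>x. 0 \<le> T x \<bullet> x)"
    using T by (auto simp: hermitian_def positive_op_def inner_eq_Re_cinner complex_nonneg_Reals_iff)
next
  assume "hermitian T \<and> (\<forall>x. 0 \<le> T x \<bullet> x)"
  then show "positive_op T"
    by (auto simp: positive_op_def hermitian_bounded_ops complex_nonneg_Reals_iff
        hermitian_cinner_real inner_eq_Re_cinner)
qed

section \<open>Spectrum and polynomials of Hermitian operators\<close>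

abbreviation real_spectrum :: "('h::chilbert_space \<Rightarrow>\<^sub>L 'h) \<Rightarrow> real set" where
  "real_spectrum T \<equiv> {x. complex_of_real x \<in> op_spectrum T}"

text \<open>The two-sided inverse of a complex-linear bijection is itself complex-linear, so the
  restriction to \<open>bounded_ops\<close> in \<open>op_spectrum\<close> excludes no
  inverse.\<close>

lemma real_spectrum_iff:
  assumes T: "T \<in> bounded_ops"
  shows "x \<in> real_spectrum T \<longleftrightarrow> \<not> invertible_op (T - x *\<^sub>R id_blinfun)"
proof -
  have "S \<in> bounded_ops"
    if S: "S o\<^sub>L (T - x *\<^sub>R id_blinfun) = id_blinfun" "(T - x *\<^sub>R id_blinfun) o\<^sub>L S = id_blinfun" for S
  proof -
    let ?U = "T - x *\<^sub>R id_blinfun"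
    have U: "?U \<in> bounded_ops" using T by (intro bounded_ops_closure)
    have SU: "S (?U v) = v" for v using S(1) by (metis blinfun_apply_blinfun_compose id_blinfun.rep_eq)
    have US: "?U (S v) = v" for v using S(2) by (metis blinfun_apply_blinfun_compose id_blinfun.rep_eq)
    have "S (scaleC c v) = scaleC c (S v)" for c v
      using SU[of "scaleC c (S v)"] U US by (simp add: bounded_ops_def)
    then show ?thesis by (simp add: bounded_ops_def)
  qed
  then show ?thesis by (auto simp: op_spectrum_def invertible_op_def)
qed

section \<open>Polynomials of an operator\<close>

lemma poly_op_0 [simp]: "poly_op 0 T = 0"
  by (simp add: poly_op_def)

text \<open>Horner's rule, the recursion behind all later inductions on polynomials. The zero
  polynomial is separate because prepending a coefficient to it does not raise the degree.\<close>

lemma poly_op_pCons: "poly_op (pCons a p) T = a *\<^sub>R id_blinfun + (T o\<^sub>L poly_op p T)"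
proof (cases "p = 0")
  case True
  then show ?thesis by (simp add: poly_op_def)
next
  case False
  have "poly_op (pCons a p) T =
      (\<Sum>i\<le>Suc (degree p). coeff (pCons a p) i *\<^sub>R (((o\<^sub>L) T ^^ i) id_blinfun))"
    using False by (simp add: poly_op_def)
  also have "\<dots> = a *\<^sub>R id_blinfun + (\<Sum>i\<le>degree p. coeff p i *\<^sub>R (T o\<^sub>L ((o\<^sub>L) T ^^ i) id_blinfun))"
    by (subst sum.atMost_Suc_shift) simp
  also have "(\<Sum>i\<le>degree p. coeff p i *\<^sub>R (T o\<^sub>L ((o\<^sub>L) T ^^ i) id_blinfun)) = T o\<^sub>L poly_op p T"
    by (simp add: poly_op_def op_comp.sum_right op_comp.scaleR_right)
  finally show ?thesis .
qed

lemma poly_op_add: "poly_op (p + q) T = poly_op p T + poly_op q T"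
  by (induction p q rule: poly_induct2)
    (simp_all add: poly_op_pCons op_comp.add_right scaleR_left_distrib)

lemma poly_op_smult: "poly_op (smult c p) T = c *\<^sub>R poly_op p T"
  by (induction p) (simp_all add: poly_op_pCons op_comp.scaleR_right scaleR_right_distrib)

lemma poly_op_diff: "poly_op (p - q) T = poly_op p T - poly_op q T"
  using poly_op_add[of p "smult (-1) q" T] poly_op_smult[of "-1" q T] by simp

lemma poly_op_mult: "poly_op (p * q) T = poly_op p T o\<^sub>L poly_op q T"
  by (induction p)
    (simp_all add: poly_op_pCons poly_op_add poly_op_smult op_comp.add_left
      op_comp.scaleR_left blinfun_compose_assoc)

lemma poly_op_commute: "poly_op p T o\<^sub>L poly_op q T = poly_op q T o\<^sub>L poly_op p T"
  by (metis mult.commute poly_op_mult)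

lemma poly_op_linear: "poly_op [:a, b:] T = a *\<^sub>R id_blinfun + b *\<^sub>R T"
  by (simp add: poly_op_pCons op_comp.scaleR_right)

text \<open>A product of commuting Hermitian operators is Hermitian, and \<open>T\<close> commutes
  with every polynomial in \<open>T\<close>.\<close>

lemma hermitian_poly_op:
  assumes "hermitian T"
  shows "hermitian (poly_op p T)"
proof (induction p)
  case 0
  show ?case by (simp add: hermitian_intros)
next
  case (pCons a p)
  have "T o\<^sub>L poly_op p T = poly_op p T o\<^sub>L T"
    using poly_op_commute[of "[:0, 1:]" T p] by (simp add: poly_op_linear)
  then have "T (poly_op p T x) = poly_op p T (T x)" for x
    by (metis blinfun_apply_blinfun_compose)
  then have "hermitian (T o\<^sub>L poly_op p T)"
    using assms pCons.IH by (simp add: hermitian_def bounded_ops_closure)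
  then show ?case by (simp only: poly_op_pCons hermitian_intros)
qed

section \<open>Real factorization and spectral invertibility\<close>

lemma poly_of_real_add:
  "poly (map_poly of_real (p + q)) z =
    poly (map_poly of_real p) z + poly (map_poly of_real q) (z :: 'a::real_field)"
  by (induction p q rule: poly_induct2) (simp_all add: map_poly_pCons algebra_simps)

lemma poly_of_real_smult:
  "poly (map_poly of_real (smult c p)) z = of_real c * poly (map_poly of_real p) (z :: 'a::real_field)"
  by (induction p) (simp_all add: map_poly_pCons algebra_simps)

lemma poly_of_real_mult:
  "poly (map_poly of_real (p * q)) z =
    poly (map_poly of_real p) z * poly (map_poly of_real q) (z :: 'a::real_field)"
  by (induction p)
    (simp_all add: map_poly_pCons poly_of_real_add poly_of_real_smult algebra_simps)

lemma poly_of_real_of_real: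
  "poly (map_poly of_real p) (of_real x :: 'a::real_field) = of_real (poly p x)"
  by (induction p) (simp_all add: map_poly_pCons)

text \<open>The fundamental theorem of algebra supplies a complex root \<open>z\<close>. If
  \<open>z = a + \<i> b\<close> is not real, the remainder modulo
  \<open>(X - a)\<^sup>2 + b\<^sup>2\<close> is a real polynomial of degree at most one vanishing at
  \<open>z\<close>, hence zero.\<close>

lemma real_poly_split:
  fixes q :: "real poly"
  assumes "degree q > 0"
  shows "(\<exists>r q'. q = [:- r, 1:] * q') \<or> (\<exists>a b q'. b \<noteq> 0 \<and> q = [:a\<^sup>2 + b\<^sup>2, - 2 * a, 1:] * q')"
proof -
  let ?h = "map_poly complex_of_real"
  have "\<not> constant (poly (?h q))"
    using assms by (simp add: constant_degree degree_map_poly)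
  then obtain z where z: "poly (?h q) z = 0"
    using fundamental_theorem_of_algebra by blast
  show ?thesis
  proof (cases "Im z = 0")
    case True
    then have "z = complex_of_real (Re z)" by (simp add: complex_eq_iff)
    then have "complex_of_real (poly q (Re z)) = 0"
      using z by (metis poly_of_real_of_real)
    then have "[:- Re z, 1:] dvd q" by (simp add: poly_eq_0_iff_dvd)
    then show ?thesis by (blast elim: dvdE)
  next
    case False
    define d where "d = [:(Re z)\<^sup>2 + (Im z)\<^sup>2, - 2 * Re z, 1:]"
    have d: "poly (?h d) z = 0"
      by (simp add: d_def map_poly_pCons complex_eq_iff power2_eq_square algebra_simps)
    have "degree (q mod d) < 2"
      using degree_mod_less[of d q] by (auto simp: d_def)
    then obtain e f where ef: "q mod d = [:e, f:]"
      by (metis less_2_cases_iff degree_eq_zeroE degree_pCons_eq_if not_less_eq pCons_cases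
          zero_less_one less_one One_nat_def pCons_0_0)
    have "poly (?h q) z = poly (?h d) z * poly (?h (q div d)) z + poly (?h (q mod d)) z"
      by (metis mult_div_mod_eq poly_of_real_add poly_of_real_mult)
    then have "complex_of_real e + complex_of_real f * z = 0"
      using z d by (simp add: ef map_poly_pCons algebra_simps)
    then have "f = 0" "e = 0" using False by (auto simp: complex_eq_iff)
    then have "q = d * (q div d)" using ef by (metis mult_div_mod_eq add.right_neutral pCons_0_0)
    then show ?thesis using False d_def by blast
  qed
qed

text \<open>By real factorization, \<open>q(T)\<close> is a product of linear factors with roots off
  the spectrum and of quadratic factors \<open>(T - a)\<^sup>2 + b\<^sup>2\<close>, which are
  bounded below by \<open>b\<^sup>2 > 0\<close>. Each factor is invertible.\<close>

lemma invertible_poly_op: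
  assumes T: "hermitian T" and "q \<noteq> 0" and "\<And>x. x \<in> real_spectrum T \<Longrightarrow> poly q x \<noteq> 0"
  shows "invertible_op (poly_op q T)"
  using assms(2,3)
proof (induction "degree q" arbitrary: q rule: less_induct)
  case less
  show ?case
  proof (cases "degree q > 0")
    case False
    then obtain c where c: "q = [:c:]" by (auto elim: degree_eq_zeroE)
    then have "c \<noteq> 0" using less.prems by auto
    then have "(1 / c) *\<^sub>R id_blinfun o\<^sub>L poly_op q T = id_blinfun"
      "poly_op q T o\<^sub>L (1 / c) *\<^sub>R id_blinfun = id_blinfun"
      by (simp_all add: c poly_op_pCons op_comp.scaleR_left op_comp.scaleR_right)
    then show ?thesis unfolding invertible_op_def by blast
  next
    case True
    have step: "invertible_op (poly_op q T)"
      if q: "q = d * q'" and d: "invertible_op (poly_op d T)" "degree d > 0" for d q'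
    proof -
      have nz: "d \<noteq> 0" "q' \<noteq> 0" using q less.prems(1) by auto
      then have "degree q' < degree q" using d(2) by (simp add: q degree_mult_eq)
      moreover have "poly q' x \<noteq> 0" if "x \<in> real_spectrum T" for x
        using less.prems(2)[OF that] by (simp add: q)
      ultimately have "invertible_op (poly_op q' T)" using less.hyps nz by blast
      then show ?thesis unfolding q poly_op_mult using d(1) by (rule invertible_op_compose[rotated])
    qed
    from real_poly_split[OF True] show ?thesis
    proof (elim disjE exE conjE)
      fix r q' assume q: "q = [:- r, 1:] * q'"
      then have "r \<notin> real_spectrum T" using less.prems(2)[of r] by auto
      then have "invertible_op (poly_op [:- r, 1:] T)"
        using real_spectrum_iff[OF hermitian_bounded_ops[OF T]] by (simp add: poly_op_linear)
      then show ?thesis using q by (intro step) auto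
    next
      fix a b q' assume b: "b \<noteq> 0" and q: "q = [:a\<^sup>2 + b\<^sup>2, - 2 * a, 1:] * q'"
      let ?d = "[:a\<^sup>2 + b\<^sup>2, - 2 * a, 1:]"
      \<comment> \<open>Completing the square exposes the factor as the square of a Hermitian
        operator plus a positive constant, as Lax-Milgram requires.\<close>
      have d: "?d = [:- a, 1:] * [:- a, 1:] + [:b\<^sup>2:]" by (simp add: power2_eq_square)
      have h: "hermitian (poly_op [:- a, 1:] T)" using T by (rule hermitian_poly_op)
      have "invertible_op (poly_op ?d T)"
      proof (rule lax_milgram)
        show "b\<^sup>2 > 0" using b by simp
        show "b\<^sup>2 * (norm x)\<^sup>2 \<le> poly_op ?d T x \<bullet> x" for x
          unfolding d poly_op_add poly_op_mult
          using hermitian_inner[OF h, of "poly_op [:- a, 1:] T x" x]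
          by (simp add: poly_op_pCons[of "b\<^sup>2"] blinfun.bilinear_simps inner_add_left power2_norm_eq_inner)
      qed
      then show ?thesis using q by (intro step) auto
    qed
  qed
qed

text \<open>Evaluate the positive form \<open>v \<mapsto> P v \<bullet> v\<close> at \<open>v = x - P x / \<parallel>P\<parallel>\<close>.\<close>

lemma positive_norm_square_le:
  assumes P: "hermitian P" "\<And>x. 0 \<le> P x \<bullet> x"
  shows "(norm (P x))\<^sup>2 \<le> norm P * (P x \<bullet> x)"
proof (cases "P = 0")
  case False
  define k where "k = 1 / norm P"
  have k: "k > 0" using False by (simp add: k_def)
  have "0 \<le> P (x - k *\<^sub>R P x) \<bullet> (x - k *\<^sub>R P x)" by (rule P(2))
  also have "\<dots> = P x \<bullet> x - 2 * k * (norm (P x))\<^sup>2 + k\<^sup>2 * (P (P x) \<bullet> P x)"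
    using hermitian_inner[OF P(1), of "P x" x] unfolding power2_norm_eq_inner
    by (simp add: blinfun.bilinear_simps inner_diff power2_eq_square algebra_simps)
  also have "P (P x) \<bullet> P x \<le> norm P * (norm (P x))\<^sup>2"
    using order_trans[OF norm_cauchy_schwarz mult_right_mono[OF norm_blinfun norm_ge_zero]]
    by (simp add: power2_eq_square mult.assoc)
  then have "k\<^sup>2 * (P (P x) \<bullet> P x) \<le> k\<^sup>2 * (norm P * (norm (P x))\<^sup>2)"
    by (intro mult_left_mono) auto
  also have "k\<^sup>2 * (norm P * (norm (P x))\<^sup>2) = k * (norm (P x))\<^sup>2"
    using False by (simp add: k_def power2_eq_square)
  finally have "k * (norm (P x))\<^sup>2 \<le> P x \<bullet> x" by simp
  then show ?thesis using False by (simp add: k_def field_simps)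
qed simp

section \<open>Numerical range, positivity and norm bounds\<close>

text \<open>With a left inverse \<open>R\<close>, \<open>norm x\<close> is at most
  \<open>norm R * norm (P x)\<close>; squaring and inserting the preceding bound on
  \<open>P x\<close> gives coercivity. The summand \<open>1\<close> in \<open>K\<close> only keeps
  it positive.\<close>

lemma invertible_positive_coercive:
  fixes P :: "'h::chilbert_space \<Rightarrow>\<^sub>L 'h"
  assumes P: "hermitian P" "\<And>x. 0 \<le> P x \<bullet> x" and "invertible_op P"
  obtains c where "c > 0" "\<And>x. c * (norm x)\<^sup>2 \<le> P x \<bullet> x"
proof -
  obtain R where R: "R o\<^sub>L P = id_blinfun"
    using assms(3) unfolding invertible_op_def by blast
  define K where "K = (norm R)\<^sup>2 * norm P + 1"
  have K: "K > 0" by (simp add: K_def add_nonneg_pos)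
  have "(1 / K) * (norm x)\<^sup>2 \<le> P x \<bullet> x" for x
  proof -
    have "norm x \<le> norm R * norm (P x)"
      using norm_blinfun[of R "P x"] R by (metis blinfun_apply_blinfun_compose blinfun_apply_id_blinfun)
    then have "(norm x)\<^sup>2 \<le> (norm R)\<^sup>2 * (norm (P x))\<^sup>2"
      unfolding power_mult_distrib[symmetric] by (intro power_mono) auto
    also have "\<dots> \<le> (norm R)\<^sup>2 * (norm P * (P x \<bullet> x))"
      using positive_norm_square_le[OF P, of x] by (intro mult_left_mono) auto
    also have "\<dots> \<le> K * (P x \<bullet> x)" using P(2)[of x] by (simp add: K_def algebra_simps)
    finally show ?thesis using K by (simp add: field_simps)
  qed
  then show ?thesis using that[of "1 / K"] K by simp
qed

text \<open>For the infimum \<open>l\<close> of the numerical range, \<open>S - l\<close> is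
  positive. Were it invertible, it would be coercive with some \<open>c > 0\<close>, and
  \<open>l + c\<close> would still be a lower bound. The vector \<open>x\<close> makes the numerical
  range nonempty.\<close>

lemma numerical_range_inf:
  fixes S :: "'h::chilbert_space \<Rightarrow>\<^sub>L 'h" and x :: 'h
  assumes S: "hermitian S" and x: "x \<noteq> 0"
  obtains l where "\<not> invertible_op (S - l *\<^sub>R id_blinfun)" "\<And>v. l * (norm v)\<^sup>2 \<le> S v \<bullet> v"
proof -
  define W where "W = (\<lambda>v. S v \<bullet> v) ` {v. norm v = 1}"
  define l where "l = Inf W"
  have "- norm S \<le> S v \<bullet> v" if "norm v = 1" for v
    using that order_trans[OF Cauchy_Schwarz_ineq2 mult_right_mono[OF norm_blinfun norm_ge_zero],
        of S v v] by simp
  then have bdd: "bdd_below W" unfolding W_def by (intro bdd_belowI[of _ "- norm S"]) auto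
  have quad: "S v \<bullet> v = (norm v)\<^sup>2 * (S (v /\<^sub>R norm v) \<bullet> (v /\<^sub>R norm v))" if "v \<noteq> 0" for v
    using that by (simp add: blinfun.bilinear_simps power2_eq_square field_simps)
  have inW: "S (v /\<^sub>R norm v) \<bullet> (v /\<^sub>R norm v) \<in> W" if "v \<noteq> 0" for v
    using that unfolding W_def by (intro imageI) simp
  have l: "l * (norm v)\<^sup>2 \<le> S v \<bullet> v" for v
  proof (cases "v = 0")
    case False
    have "(norm v)\<^sup>2 * l \<le> (norm v)\<^sup>2 * (S (v /\<^sub>R norm v) \<bullet> (v /\<^sub>R norm v))"
      unfolding l_def using cInf_lower[OF inW[OF False] bdd] by (intro mult_left_mono) auto
    then show ?thesis using quad[OF False] by (simp add: mult.commute)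
  qed simp
  let ?P = "S - l *\<^sub>R id_blinfun"
  have P: "?P v \<bullet> v = S v \<bullet> v - l * (norm v)\<^sup>2" for v
    by (simp add: blinfun.bilinear_simps inner_diff_left power2_norm_eq_inner)
  have "\<not> invertible_op ?P"
  proof
    assume "invertible_op ?P"
    moreover have "hermitian ?P" using S by (intro hermitian_intros)
    ultimately obtain c where c: "c > 0" "\<And>v. c * (norm v)\<^sup>2 \<le> ?P v \<bullet> v"
      using invertible_positive_coercive[of ?P] P l by (metis diff_ge_0_iff_ge)
    have "l + c \<le> S v \<bullet> v" if "norm v = 1" for v
      using c(2)[of v] that by (simp add: P)
    then have "l + c \<le> w" if "w \<in> W" for w
      using that unfolding W_def by blast
    then have "l + c \<le> l"
      unfolding l_def using inW[OF x] by (intro cInf_greatest) auto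
    then show False using c(1) by simp
  qed
  then show ?thesis using that l by blast
qed

text \<open>The infimum \<open>l\<close> of the numerical range of \<open>p(T)\<close> is a spectral value of \<open>p(T)\<close>; if \<open>l\<close> were
  negative, \<open>p - l\<close> would have no zero on the spectrum of \<open>T\<close>.\<close>

lemma poly_op_nonneg:
  fixes T :: "'h::chilbert_space \<Rightarrow>\<^sub>L 'h"
  assumes T: "hermitian T" and p: "\<And>x. x \<in> real_spectrum T \<Longrightarrow> 0 \<le> poly p x"
  shows "0 \<le> poly_op p T x \<bullet> x"
proof (rule ccontr)
  assume neg: "\<not> 0 \<le> poly_op p T x \<bullet> x"
  then have x: "x \<noteq> 0" by auto
  \<comment> \<open>A spectral point of \<open>T\<close> itself is needed to see that
    \<open>p - [:l:]\<close> is not the zero polynomial.\<close>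
  obtain y where y: "y \<in> real_spectrum T"
    using numerical_range_inf[OF T x] real_spectrum_iff[OF hermitian_bounded_ops[OF T]] by metis
  obtain l where l: "\<not> invertible_op (poly_op p T - l *\<^sub>R id_blinfun)"
    "\<And>v. l * (norm v)\<^sup>2 \<le> poly_op p T v \<bullet> v"
    using numerical_range_inf[OF hermitian_poly_op[OF T] x] by metis
  have "l < 0"
    using l(2)[of x] neg by (smt (verit) mult_nonneg_nonneg zero_le_power2)
  then have "poly (p - [:l:]) y \<noteq> 0" if "y \<in> real_spectrum T" for y
    using p[OF that] by simp
  moreover from this[OF y] have "p - [:l:] \<noteq> 0" by auto
  ultimately have "invertible_op (poly_op (p - [:l:]) T)"
    by (intro invertible_poly_op[OF T])
  then show False using l(1) by (simp add: poly_op_diff poly_op_pCons[of l])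
qed

text \<open>Positivity of \<open>c\<^sup>2 - p\<^sup>2\<close> on the spectrum transfers to the
  operators and bounds the square of the norm of \<open>p(T) x\<close>.\<close>

lemma norm_poly_op_le:
  fixes T :: "'h::chilbert_space \<Rightarrow>\<^sub>L 'h"
  assumes T: "hermitian T" and c: "0 \<le> c" and p: "\<And>x. x \<in> real_spectrum T \<Longrightarrow> \<bar>poly p x\<bar> \<le> c"
  shows "norm (poly_op p T) \<le> c"
proof (rule norm_blinfun_bound[OF c])
  fix x
  have "0 \<le> poly_op ([:c\<^sup>2:] - p * p) T x \<bullet> x"
  proof (rule poly_op_nonneg[OF T])
    show "0 \<le> poly ([:c\<^sup>2:] - p * p) x" if "x \<in> real_spectrum T" for x
      using p[OF that] c by (simp add: power2_le_iff_abs_le power2_eq_square[symmetric])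
  qed
  then have "(norm (poly_op p T x))\<^sup>2 \<le> (c * norm x)\<^sup>2"
    using hermitian_inner[OF hermitian_poly_op[OF T], of p "poly_op p T x" x]
    by (simp add: poly_op_diff poly_op_mult poly_op_pCons[of "c\<^sup>2"] blinfun.bilinear_simps
        inner_diff_left power2_norm_eq_inner power_mult_distrib)
  then show "norm (poly_op p T x) \<le> c * norm x"
    by (rule power2_le_imp_le) (use c in simp)
qed

text \<open>To the left of \<open>a\<close> the operator \<open>T - y\<close> is coercive, to the
  right of \<open>b\<close> the operator \<open>y - T\<close> is; both cases are excluded by
  Lax-Milgram.\<close>

lemma real_spectrum_subset:
  assumes T: "hermitian T"
    and lower: "\<And>x. a * (norm x)\<^sup>2 \<le> T x \<bullet> x" and upper: "\<And>x. T x \<bullet> x \<le> b * (norm x)\<^sup>2"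
  shows "real_spectrum T \<subseteq> {a..b}"
proof
  fix y assume "y \<in> real_spectrum T"
  then have y: "\<not> invertible_op (T - y *\<^sub>R id_blinfun)"
    using real_spectrum_iff[OF hermitian_bounded_ops[OF T]] by blast
  have "a \<le> y"
  proof (rule ccontr)
    assume "\<not> a \<le> y"
    then have "invertible_op (T - y *\<^sub>R id_blinfun)"
      using lower
      by (intro lax_milgram[of "a - y"])
        (simp_all add: blinfun.bilinear_simps inner_diff_left power2_norm_eq_inner algebra_simps)
    then show False using y by simp
  qed
  moreover have "y \<le> b"
  proof (rule ccontr)
    assume "\<not> y \<le> b"
    then have "invertible_op (y *\<^sub>R id_blinfun - T)"
      using upper
      by (intro lax_milgram[of "y - b"])
        (simp_all add: blinfun.bilinear_simps inner_diff_left power2_norm_eq_inner algebra_simps)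
    then obtain R where R: "R o\<^sub>L (y *\<^sub>R id_blinfun - T) = id_blinfun"
      "(y *\<^sub>R id_blinfun - T) o\<^sub>L R = id_blinfun"
      unfolding invertible_op_def by blast
    then have "(- R) o\<^sub>L (T - y *\<^sub>R id_blinfun) = id_blinfun"
      "(T - y *\<^sub>R id_blinfun) o\<^sub>L (- R) = id_blinfun"
      by (simp_all add: op_comp.minus_left op_comp.minus_right op_comp.diff_left op_comp.diff_right)
    then show False using y unfolding invertible_op_def by blast
  qed
  ultimately show "y \<in> {a..b}" by simp
qed

section \<open>Continuous functional calculus\<close>

text \<open>Makes the bounded operators a Banach space, so that Cauchy sequences of polynomials in
  \<open>T\<close> converge.\<close>

instance chilbert_space \<subseteq> banach ..

lemma bounded_ops_limit:
  assumes "\<And>n. S n \<in> bounded_ops" and lim: "S \<longlonglongrightarrow> (T :: 'h::chilbert_space \<Rightarrow>\<^sub>L 'h)"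
  shows "T \<in> bounded_ops"
  unfolding bounded_ops_def
proof (intro CollectI allI)
  fix c x
  have lim': "(\<lambda>n. S n x) \<longlonglongrightarrow> T x" for x
    using blinfun.tendsto[OF lim tendsto_const] .
  have "(\<lambda>n. S n (scaleC c x)) = (\<lambda>n. scaleC c (S n x))"
    using assms(1) by (simp add: bounded_ops_def)
  then have "(\<lambda>n. S n (scaleC c x)) \<longlonglongrightarrow> scaleC c (T x)"
    using bounded_linear.tendsto[OF bounded_linear_scaleC lim'] by simp
  then show "T (scaleC c x) = scaleC c (T x)"
    using lim' LIMSEQ_unique by blast
qed

lemma hermitian_limit:
  assumes S: "\<And>n. hermitian (S n)" and lim: "S \<longlonglongrightarrow> (T :: 'h::chilbert_space \<Rightarrow>\<^sub>L 'h)"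
  shows "hermitian T"
proof -
  have "T x \<bullet> y = x \<bullet> T y" for x y
  proof (rule LIMSEQ_unique)
    show "(\<lambda>n. S n x \<bullet> y) \<longlonglongrightarrow> T x \<bullet> y"
      by (intro tendsto_inner blinfun.tendsto lim tendsto_const)
    show "(\<lambda>n. S n x \<bullet> y) \<longlonglongrightarrow> x \<bullet> T y"
      unfolding hermitian_inner[OF S] by (intro tendsto_inner blinfun.tendsto lim tendsto_const)
  qed
  then show ?thesis
    using bounded_ops_limit[OF _ lim] S by (simp add: hermitian_def)
qed

section \<open>Polynomial approximation and existence of the calculus\<close>

lemma poly_approx:
  assumes "compact K" and "continuous_on K (f :: real \<Rightarrow> real)"
  obtains p where "uniform_limit K (\<lambda>n. poly (p n)) f sequentially"
proof -
  have "\<exists>p. \<forall>x\<in>K. \<bar>f x - poly p x\<bar> < 1 / Suc n" for n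
  proof -
    obtain g where g: "real_polynomial_function g" "\<And>x. x \<in> K \<Longrightarrow> \<bar>f x - g x\<bar> < 1 / Suc n"
      using Stone_Weierstrass_real_polynomial_function[OF assms, of "1 / Suc n"] by auto
    then obtain a m where "g = (\<lambda>x. \<Sum>i\<le>m. a i * x ^ i)"
      using real_polynomial_function_iff_sum by blast
    then have "g = poly (\<Sum>i\<le>m. monom (a i) i)"
      by (simp add: fun_eq_iff poly_sum poly_monom)
    then show ?thesis using g(2) by blast
  qed
  then obtain p where p: "\<And>n x. x \<in> K \<Longrightarrow> \<bar>f x - poly (p n) x\<bar> < 1 / Suc n"
    by metis
  have "uniform_limit K (\<lambda>n. poly (p n)) f sequentially"
  proof (rule uniform_limitI)
    fix e :: real assume "e > 0"
    then obtain N where N: "1 / Suc N < e" using nat_approx_posE by blast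
    have "dist (poly (p n) x) (f x) < e" if "n \<ge> N" "x \<in> K" for n x
    proof -
      have "\<bar>f x - poly (p n) x\<bar> < 1 / Suc n" using p that by blast
      also have "\<dots> \<le> 1 / Suc N" using that(1) by (simp add: field_simps)
      finally show ?thesis using N by (simp add: dist_real_def abs_minus_commute)
    qed
    then show "\<forall>\<^sub>F n in sequentially. \<forall>x\<in>K. dist (poly (p n) x) (f x) < e"
      unfolding eventually_sequentially by blast
  qed
  then show ?thesis using that by blast
qed

text \<open>Two sequences are compared at once: with \<open>p = q\<close> this is the Cauchy
  property, and with different sequences it shows that the limit depends on \<open>f\<close>
  alone.\<close>

lemma poly_op_uniform_limit:
  fixes T :: "'h::chilbert_space \<Rightarrow>\<^sub>L 'h"
  assumes T: "hermitian T"
    and p: "uniform_limit (real_spectrum T) (\<lambda>n. poly (p n)) f sequentially"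
    and q: "uniform_limit (real_spectrum T) (\<lambda>n. poly (q n)) f sequentially"
    and e: "e > 0"
  shows "\<exists>N. \<forall>m\<ge>N. \<forall>n\<ge>N. dist (poly_op (p m) T) (poly_op (q n) T) < e"
proof -
  have "\<forall>\<^sub>F n in sequentially. \<forall>x\<in>real_spectrum T. dist (poly (p n) x) (f x) < e / 4 \<and>
      dist (poly (q n) x) (f x) < e / 4"
    using uniform_limitD[OF p, of "e / 4"] uniform_limitD[OF q, of "e / 4"] e
    by (auto elim: eventually_elim2)
  then obtain N where N: "\<And>n x. n \<ge> N \<Longrightarrow> x \<in> real_spectrum T \<Longrightarrow>
      dist (poly (p n) x) (f x) < e / 4 \<and> dist (poly (q n) x) (f x) < e / 4"
    unfolding eventually_sequentially by blast
  have "dist (poly_op (p m) T) (poly_op (q n) T) < e" if "m \<ge> N" "n \<ge> N" for m n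
  proof -
    have "\<bar>poly (p m - q n) x\<bar> \<le> e / 2" if "x \<in> real_spectrum T" for x
      using N[OF \<open>m \<ge> N\<close> that] N[OF \<open>n \<ge> N\<close> that]
      unfolding dist_real_def poly_diff by linarith
    then have "norm (poly_op (p m - q n) T) \<le> e / 2"
      using e by (intro norm_poly_op_le[OF T]) auto
    then show ?thesis using e by (simp add: dist_norm poly_op_diff)
  qed
  then show ?thesis by blast
qed

text \<open>Justifies the definite description in \<open>cfc\<close>. Uniqueness rests on the
  existence of at least one approximating sequence, without which the defining implication would
  hold vacuously for every operator.\<close>

lemma cfc_tendsto:
  fixes T :: "'h::chilbert_space \<Rightarrow>\<^sub>L 'h"
  assumes T: "hermitian T" and K: "real_spectrum T \<subseteq> K" "compact K" and f: "continuous_on K f"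
    and p: "uniform_limit (real_spectrum T) (\<lambda>n. poly (p n)) f sequentially"
  shows "(\<lambda>n. poly_op (p n) T) \<longlonglongrightarrow> cfc f T"
proof -
  let ?P = "\<lambda>S. \<forall>p. uniform_limit (real_spectrum T) (\<lambda>n. poly (p n)) f sequentially
      \<longrightarrow> (\<lambda>n. poly_op (p n) T) \<longlonglongrightarrow> S"
  obtain q where "uniform_limit K (\<lambda>n. poly (q n)) f sequentially"
    using poly_approx[OF K(2) f] .
  then have q: "uniform_limit (real_spectrum T) (\<lambda>n. poly (q n)) f sequentially"
    using K(1) by (rule uniform_limit_on_subset)
  have "Cauchy (\<lambda>n. poly_op (q n) T)"
    using poly_op_uniform_limit[OF T q q] by (intro metric_CauchyI) blast
  then obtain S where S: "(\<lambda>n. poly_op (q n) T) \<longlonglongrightarrow> S"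
    using Cauchy_convergent convergent_def by blast
  have "?P S"
  proof (intro allI impI)
    fix p assume p: "uniform_limit (real_spectrum T) (\<lambda>n. poly (p n)) f sequentially"
    have "(\<lambda>n. dist (poly_op (p n) T) (poly_op (q n) T)) \<longlonglongrightarrow> 0"
      using poly_op_uniform_limit[OF T p q] by (intro metric_LIMSEQ_I) fastforce
    then have "(\<lambda>n. poly_op (p n) T - poly_op (q n) T) \<longlonglongrightarrow> 0"
      by (simp add: dist_norm tendsto_norm_zero_iff)
    from tendsto_add[OF this S] show "(\<lambda>n. poly_op (p n) T) \<longlonglongrightarrow> S" by simp
  qed
  moreover have "S' = S" if "?P S'" for S'
    using that q S LIMSEQ_unique by blast
  ultimately have "?P (cfc f T)" unfolding cfc_def by (rule theI)
  then show ?thesis using p by blast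
qed

text \<open>\<open>K\<close> may be any compact set containing the real spectrum. Continuity is then
  checked on a convenient interval rather than on the spectrum itself.\<close>

locale spectral_bound =
  fixes T :: "'h::chilbert_space \<Rightarrow>\<^sub>L 'h" and K :: "real set"
  assumes herm: "hermitian T" and spec: "real_spectrum T \<subseteq> K" and compact: "compact K"
begin

lemma cfc_approx:
  assumes f: "continuous_on K f"
  obtains p where "uniform_limit K (\<lambda>n. poly (p n)) f sequentially"
    "(\<lambda>n. poly_op (p n) T) \<longlonglongrightarrow> cfc f T"
  using poly_approx[OF compact f] cfc_tendsto[OF herm spec compact f]
    uniform_limit_on_subset[OF _ spec] by metis

lemma cfc_eqI:
  assumes f: "continuous_on K f" and p: "uniform_limit K (\<lambda>n. poly (p n)) f sequentially"
    and "(\<lambda>n. poly_op (p n) T) \<longlonglongrightarrow> S"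
  shows "cfc f T = S"
  using cfc_tendsto[OF herm spec compact f uniform_limit_on_subset[OF p spec]] assms(3)
  by (rule LIMSEQ_unique)

lemma cfc_poly: "cfc (poly p) T = poly_op p T"
  by (rule cfc_eqI[where p = "\<lambda>_. p"])
    (auto intro!: continuous_intros uniform_limit_const)

lemma cfc_linear:
  assumes f: "continuous_on K f" and g: "continuous_on K g"
  shows "cfc (\<lambda>x. a * f x + c * g x) T = a *\<^sub>R cfc f T + c *\<^sub>R cfc g T"
proof -
  obtain p where p: "uniform_limit K (\<lambda>n. poly (p n)) f sequentially"
    "(\<lambda>n. poly_op (p n) T) \<longlonglongrightarrow> cfc f T" using cfc_approx[OF f] .
  obtain q where q: "uniform_limit K (\<lambda>n. poly (q n)) g sequentially"
    "(\<lambda>n. poly_op (q n) T) \<longlonglongrightarrow> cfc g T" using cfc_approx[OF g] .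
  show ?thesis
  proof (rule cfc_eqI)
    show "continuous_on K (\<lambda>x. a * f x + c * g x)" using f g by (intro continuous_intros)
    have "uniform_limit K (\<lambda>n x. a * poly (p n) x + c * poly (q n) x) (\<lambda>x. a * f x + c * g x) sequentially"
      using p(1) q(1)
      by (intro uniform_limit_add bounded_linear.uniform_limit[OF bounded_linear_mult_right])
    then show "uniform_limit K (\<lambda>n. poly (smult a (p n) + smult c (q n))) (\<lambda>x. a * f x + c * g x) sequentially"
      by (simp add: uniform_limit_iff)
    show "(\<lambda>n. poly_op (smult a (p n) + smult c (q n)) T) \<longlonglongrightarrow> a *\<^sub>R cfc f T + c *\<^sub>R cfc g T"
      unfolding poly_op_add poly_op_smult by (intro tendsto_intros p(2) q(2))
  qed
qed

lemma cfc_mult: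
  assumes f: "continuous_on K f" and g: "continuous_on K g"
  shows "cfc (\<lambda>x. f x * g x) T = cfc f T o\<^sub>L cfc g T"
proof -
  obtain p where p: "uniform_limit K (\<lambda>n. poly (p n)) f sequentially"
    "(\<lambda>n. poly_op (p n) T) \<longlonglongrightarrow> cfc f T" using cfc_approx[OF f] .
  obtain q where q: "uniform_limit K (\<lambda>n. poly (q n)) g sequentially"
    "(\<lambda>n. poly_op (q n) T) \<longlonglongrightarrow> cfc g T" using cfc_approx[OF g] .
  show ?thesis
  proof (rule cfc_eqI)
    show "continuous_on K (\<lambda>x. f x * g x)" using f g by (intro continuous_intros)
    have "bounded (f ` K)" "bounded (g ` K)"
      using f g compact by (simp_all add: compact_continuous_image compact_imp_bounded)
    then have "uniform_limit K (\<lambda>n x. poly (p n) x * poly (q n) x) (\<lambda>x. f x * g x) sequentially"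
      using p(1) q(1) by (intro uniform_lim_mult)
    then show "uniform_limit K (\<lambda>n. poly (p n * q n)) (\<lambda>x. f x * g x) sequentially"
      by (simp add: uniform_limit_iff)
    show "(\<lambda>n. poly_op (p n * q n) T) \<longlonglongrightarrow> (cfc f T o\<^sub>L cfc g T)"
      unfolding poly_op_mult by (intro op_comp.tendsto p(2) q(2))
  qed
qed

lemma hermitian_cfc:
  assumes f: "continuous_on K f"
  shows "hermitian (cfc f T)"
proof -
  obtain p where "(\<lambda>n. poly_op (p n) T) \<longlonglongrightarrow> cfc f T" using cfc_approx[OF f] .
  then show ?thesis by (rule hermitian_limit[OF hermitian_poly_op[OF herm]])
qed

lemma norm_cfc_le:
  assumes f: "continuous_on K f" and c: "0 \<le> c" "\<And>x. x \<in> K \<Longrightarrow> \<bar>f x\<bar> \<le> c"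
  shows "norm (cfc f T) \<le> c"
proof (rule field_le_epsilon)
  fix e :: real assume e: "e > 0"
  obtain p where p: "uniform_limit K (\<lambda>n. poly (p n)) f sequentially"
    "(\<lambda>n. poly_op (p n) T) \<longlonglongrightarrow> cfc f T" using cfc_approx[OF f] .
  have "\<forall>\<^sub>F n in sequentially. norm (poly_op (p n) T) \<le> c + e"
    using uniform_limitD[OF p(1) e]
  proof eventually_elim
    case (elim n)
    have "\<bar>poly (p n) x\<bar> \<le> c + e" if "x \<in> K" for x
    proof -
      have "\<bar>poly (p n) x - f x\<bar> < e" using elim that by (simp add: dist_real_def)
      then show ?thesis using c(2)[OF that] by linarith
    qed
    then show ?case using spec c(1) e by (intro norm_poly_op_le[OF herm]) auto
  qed
  then show "norm (cfc f T) \<le> c + e"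
    using tendsto_norm[OF p(2)] by (intro tendsto_upperbound) auto
qed

end

section \<open>Translation of the operator by a scalar\<close>

lemma poly_op_pcompose: "poly_op (pcompose p q) T = poly_op p (poly_op q T)"
proof (induction p)
  case (pCons a p)
  then show ?case
    by (simp add: pcompose_pCons poly_op_add poly_op_mult poly_op_pCons)
qed simp

lemma spectral_bound_shift:
  assumes "spectral_bound T K"
  shows "spectral_bound (T + t *\<^sub>R id_blinfun) ((\<lambda>x. x + t) ` K)"
proof -
  interpret spectral_bound T K by fact
  have h: "hermitian (T + t *\<^sub>R id_blinfun)" using herm by (intro hermitian_intros)
  have eq: "T + t *\<^sub>R id_blinfun - y *\<^sub>R id_blinfun = T - (y - t) *\<^sub>R id_blinfun" for y
    by (simp only: scaleR_diff_left diff_diff_eq2)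
  have "y - t \<in> real_spectrum T" if "y \<in> real_spectrum (T + t *\<^sub>R id_blinfun)" for y
    using that unfolding real_spectrum_iff[OF hermitian_bounded_ops[OF h]]
      real_spectrum_iff[OF hermitian_bounded_ops[OF herm]] eq .
  then have "real_spectrum (T + t *\<^sub>R id_blinfun) \<subseteq> (\<lambda>x. x + t) ` K"
    using spec by (intro subsetI image_eqI[where x = "_ - t"]) (auto simp del: of_real_diff)
  then show ?thesis
    using h compact by unfold_locales (auto intro!: compact_continuous_image continuous_intros)
qed

text \<open>If \<open>p n\<close> approximates \<open>f(x + t)\<close> on \<open>K\<close>, then
  \<open>p n\<close> composed with \<open>X - t\<close> approximates \<open>f\<close> on the shifted
  set and takes at \<open>T + t\<close> the value of \<open>p n\<close> at \<open>T\<close>.\<close>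

lemma cfc_shift:
  assumes "spectral_bound T K" and f: "continuous_on ((\<lambda>x. x + t) ` K) f"
  shows "cfc f (T + t *\<^sub>R id_blinfun) = cfc (\<lambda>x. f (x + t)) T"
proof -
  interpret spectral_bound T K by fact
  interpret S: spectral_bound "T + t *\<^sub>R id_blinfun" "(\<lambda>x. x + t) ` K"
    by (rule spectral_bound_shift) fact
  have "continuous_on K (\<lambda>x. f (x + t))"
    using f by (intro continuous_on_compose2[OF f]) (auto intro!: continuous_intros)
  then obtain p where p: "uniform_limit K (\<lambda>n. poly (p n)) (\<lambda>x. f (x + t)) sequentially"
    "(\<lambda>n. poly_op (p n) T) \<longlonglongrightarrow> cfc (\<lambda>x. f (x + t)) T" by (rule cfc_approx)
  show ?thesis
  proof (rule S.cfc_eqI[OF f])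
    show "uniform_limit ((\<lambda>x. x + t) ` K) (\<lambda>n. poly (pcompose (p n) [:- t, 1:])) f sequentially"
      using p(1) by (simp add: uniform_limit_iff poly_pcompose)
    show "(\<lambda>n. poly_op (pcompose (p n) [:- t, 1:]) (T + t *\<^sub>R id_blinfun)) \<longlonglongrightarrow> cfc (\<lambda>x. f (x + t)) T"
      using p(2) by (simp add: poly_op_pcompose poly_op_linear)
  qed
qed

section \<open>Translations under a bounded functional\<close>

lemma continuous_on_eta: "continuous_on {0..} eta"
proof -
  have "(eta \<longlongrightarrow> eta x) (at x within {0..})" if "x \<ge> 0" for x
  proof (cases "x = 0")
    case True
    have "((\<lambda>x::real. x * ln x) \<longlongrightarrow> 0) (at_right 0)" by real_asymp
    moreover have "\<forall>\<^sub>F x in at_right 0. x * ln x = eta x"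
      using eventually_at_right_less[of 0] by eventually_elim (simp add: eta_def)
    ultimately have "(eta \<longlongrightarrow> 0) (at_right 0)" by (rule Lim_transform_eventually)
    then show ?thesis using True by (simp add: eta_def at_within_Ici_at_right)
  next
    case False
    have "((\<lambda>x. x * ln x) \<longlongrightarrow> x * ln x) (at x within {0..})"
      using False by (intro tendsto_intros) auto
    moreover have "\<forall>\<^sub>F y in at x within {0..}. y * ln y = eta y"
      by (simp add: eta_def)
    ultimately show ?thesis using False by (auto simp: eta_def elim: Lim_transform_eventually)
  qed
  then show ?thesis by (simp add: continuous_on_def)
qed

text \<open>Abstracts the passage from \<open>f\<close> to the state of \<open>f(C)\<close> for
  positive \<open>C\<close> of norm \<open>b\<close>. Linearity and the bound are demanded for
  continuous functions only, where the calculus has a meaning.\<close>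

locale bounded_functional =
  fixes E :: "(real \<Rightarrow> real) \<Rightarrow> real" and b :: real
  assumes linear: "\<And>f g a c. continuous_on {0..b} f \<Longrightarrow> continuous_on {0..b} g \<Longrightarrow>
      E (\<lambda>x. a * f x + c * g x) = a * E f + c * E g"
    and bound: "\<And>f c. continuous_on {0..b} f \<Longrightarrow> 0 \<le> c \<Longrightarrow> (\<And>x. x \<in> {0..b} \<Longrightarrow> \<bar>f x\<bar> \<le> c) \<Longrightarrow> \<bar>E f\<bar> \<le> c"
    and one: "E (\<lambda>_. 1) = 1"
begin

text \<open>The supremum bound makes \<open>E\<close> a contraction, hence continuous under uniform
  limits.\<close>

lemma tendsto:
  assumes g: "\<forall>\<^sub>F t in F. continuous_on {0..b} (g t)" and h: "continuous_on {0..b} h"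
    and lim: "uniform_limit {0..b} g h F"
  shows "((\<lambda>t. E (g t)) \<longlongrightarrow> E h) F"
proof (rule tendstoI)
  fix e :: real assume e: "e > 0"
  have "\<forall>\<^sub>F t in F. \<forall>x\<in>{0..b}. dist (g t x) (h x) < e / 2"
    using e by (intro uniform_limitD[OF lim]) simp
  with g show "\<forall>\<^sub>F t in F. dist (E (g t)) (E h) < e"
  proof eventually_elim
    case (elim t)
    have "\<bar>E (\<lambda>x. 1 * g t x + (- 1) * h x)\<bar> \<le> e / 2"
    proof (rule bound)
      show "continuous_on {0..b} (\<lambda>x. 1 * g t x + (- 1) * h x)"
        using elim(1) h by (intro continuous_intros)
    qed (use e elim(2) in \<open>force simp: dist_real_def\<close>)+
    then show ?case
      using linear[OF elim(1) h, of 1 "- 1"] e by (simp add: dist_real_def)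
  qed
qed

text \<open>The difference quotients converge uniformly in \<open>x\<close>: each equals
  \<open>\<psi> z\<close> for some \<open>z\<close> within \<open>\<bar>h\<bar>\<close> of
  \<open>x + t\<close>, and \<open>\<psi>\<close> is uniformly continuous near the relevant
  interval.\<close>

lemma has_derivative_translate:
  assumes \<phi>: "\<And>x. x > 0 \<Longrightarrow> (\<phi> has_real_derivative \<psi> x) (at x)"
    and \<psi>: "continuous_on {0<..} \<psi>" and t: "t > 0"
  shows "((\<lambda>t. E (\<lambda>x. \<phi> (x + t))) has_real_derivative E (\<lambda>x. \<psi> (x + t))) (at t)"
proof -
  have cont: "continuous_on {0..b} (\<lambda>x. \<phi> (x + s))" if "s > 0" for s
  proof (rule continuous_on_compose2[of "{0<..}" \<phi>])
    show "continuous_on {0<..} \<phi>"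
      using \<phi> by (auto intro!: continuous_at_imp_continuous_on DERIV_isCont)
  qed (use that in \<open>auto intro!: continuous_intros\<close>)
  have cont': "continuous_on {0..b} (\<lambda>x. \<psi> (x + t))"
    by (rule continuous_on_compose2[OF \<psi>]) (use t in \<open>auto intro!: continuous_intros\<close>)
  define q where "q h = (\<lambda>x. 1 / h * \<phi> (x + (t + h)) + - (1 / h) * \<phi> (x + t))" for h
  have near: "\<forall>\<^sub>F h in at 0. h \<noteq> 0 \<and> \<bar>h\<bar> < \<delta>" if "\<delta> > 0" for \<delta> :: real
    unfolding eventually_at using that by (auto simp: dist_real_def)
  have "((\<lambda>h. E (q h)) \<longlongrightarrow> E (\<lambda>x. \<psi> (x + t))) (at 0)"
  proof (rule tendsto[OF _ cont'])
    show "\<forall>\<^sub>F h in at 0. continuous_on {0..b} (q h)"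
      using near[OF t]
    proof eventually_elim
      case (elim h)
      then show ?case unfolding q_def using t by (intro continuous_intros cont) auto
    qed
    \<comment> \<open>This interval stays away from \<open>0\<close> and contains every point within
      \<open>t / 2\<close> of some \<open>x + t\<close>.\<close>
    have "uniformly_continuous_on {t / 2..b + 2 * t} \<psi>"
      using t by (intro compact_uniformly_continuous continuous_on_subset[OF \<psi>]) auto
    then have uc: "\<exists>\<delta>>0. \<forall>x\<in>{t / 2..b + 2 * t}. \<forall>y\<in>{t / 2..b + 2 * t}.
        dist y x < \<delta> \<longrightarrow> dist (\<psi> y) (\<psi> x) < e" if "e > 0" for e
      using that unfolding uniformly_continuous_on_def by blast
    show "uniform_limit {0..b} q (\<lambda>x. \<psi> (x + t)) (at 0)"
    proof (rule uniform_limitI)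
      fix e :: real assume "e > 0"
      then obtain \<delta> where \<delta>: "\<delta> > 0" "\<And>x y. x \<in> {t / 2..b + 2 * t} \<Longrightarrow> y \<in> {t / 2..b + 2 * t} \<Longrightarrow>
          dist y x < \<delta> \<Longrightarrow> dist (\<psi> y) (\<psi> x) < e" using uc by meson
      have "\<forall>\<^sub>F h in at 0. h \<noteq> 0 \<and> \<bar>h\<bar> < min \<delta> (t / 2)"
        using \<delta>(1) t by (intro near) auto
      then show "\<forall>\<^sub>F h in at 0. \<forall>x\<in>{0..b}. dist (q h x) (\<psi> (x + t)) < e"
      proof eventually_elim
        case (elim h)
        show ?case
        proof
          fix x assume x: "x \<in> {0..b}"
          have "\<exists>z. \<bar>z - (x + t)\<bar> \<le> \<bar>h\<bar> \<and> \<phi> (x + (t + h)) - \<phi> (x + t) = h * \<psi> z"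
          proof (cases "h > 0")
            case True
            have "\<exists>z. x + t < z \<and> z < x + (t + h) \<and>
                \<phi> (x + (t + h)) - \<phi> (x + t) = ((x + (t + h)) - (x + t)) * \<psi> z"
              using True x t by (intro MVT2 \<phi>) auto
            then obtain z where "x + t < z" "z < x + (t + h)" "\<phi> (x + (t + h)) - \<phi> (x + t) = h * \<psi> z"
              by auto
            then show ?thesis by (intro exI[of _ z]) auto
          next
            case False
            have "\<exists>z. x + (t + h) < z \<and> z < x + t \<and>
                \<phi> (x + t) - \<phi> (x + (t + h)) = ((x + t) - (x + (t + h))) * \<psi> z"
              using False elim x t by (intro MVT2 \<phi>) auto
            then obtain z where "x + (t + h) < z" "z < x + t" "\<phi> (x + t) - \<phi> (x + (t + h)) = - h * \<psi> z"
              by auto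
            then show ?thesis by (intro exI[of _ z]) auto
          qed
          then obtain z where z: "\<bar>z - (x + t)\<bar> \<le> \<bar>h\<bar>" "\<phi> (x + (t + h)) - \<phi> (x + t) = h * \<psi> z"
            by blast
          have "q h x = \<psi> z" using z(2) elim by (simp add: q_def field_simps)
          moreover have "dist (\<psi> z) (\<psi> (x + t)) < e"
            using z(1) elim x t by (intro \<delta>(2)) (auto simp: dist_real_def)
          ultimately show "dist (q h x) (\<psi> (x + t)) < e" by simp
        qed
      qed
    qed
  qed
  moreover have "\<forall>\<^sub>F h in at 0. E (q h) = (E (\<lambda>x. \<phi> (x + (t + h))) - E (\<lambda>x. \<phi> (x + t))) / h"
    using near[OF t]
  proof eventually_elim
    case (elim h)
    then have "t + h > 0" by auto
    then show ?case
      unfolding q_def using t by (subst linear) (auto intro!: cont simp: diff_divide_distrib)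
  qed
  ultimately show ?thesis
    unfolding DERIV_def by (rule Lim_transform_eventually)
qed

section \<open>Translates of the logarithm and of \<open>eta\<close>\<close>

lemma ln_derivative:
  "t > 0 \<Longrightarrow> ((\<lambda>t. E (\<lambda>x. ln (x + t))) has_real_derivative E (\<lambda>x. inverse (x + t))) (at t)"
  by (rule has_derivative_translate)
    (auto intro!: derivative_eq_intros continuous_intros simp: divide_inverse)

lemma eta_derivative:
  assumes t: "t > 0"
  shows "((\<lambda>t. E (\<lambda>x. eta (x + t))) has_real_derivative E (\<lambda>x. ln (x + t)) + 1) (at t)"
proof -
  have "(eta has_real_derivative ln x + 1) (at x)" if "x > 0" for x
  proof (rule has_field_derivative_transform_within_open[where S = "{0<..}"])
    show "((\<lambda>x. x * ln x) has_real_derivative ln x + 1) (at x)"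
      using that by (auto intro!: derivative_eq_intros)
  qed (use that in \<open>auto simp: eta_def\<close>)
  then have "((\<lambda>t. E (\<lambda>x. eta (x + t))) has_real_derivative E (\<lambda>x. ln (x + t) + 1)) (at t)"
    using t by (intro has_derivative_translate) (auto intro!: continuous_intros)
  also have "E (\<lambda>x. ln (x + t) + 1) = E (\<lambda>x. ln (x + t)) + 1"
    using linear[of "\<lambda>x. ln (x + t)" "\<lambda>_. 1" 1 1] t by (simp add: one continuous_intros)
  finally show ?thesis .
qed

text \<open>Subtracting \<open>ln t\<close> leaves \<open>ln (1 + x / t)\<close>, which lies between
  \<open>0\<close> and \<open>b / t\<close> on the interval.\<close>

lemma ln_at_top: "((\<lambda>t. E (\<lambda>x. ln (x + t)) - ln t) \<longlongrightarrow> 0) at_top"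
proof -
  have cont: "continuous_on {0..b} (\<lambda>x. ln (x + t))" if "t > 0" for t
    using that by (intro continuous_intros) auto
  have "((\<lambda>t. E (\<lambda>x. 1 * ln (x + t) + (- ln t) * 1)) \<longlongrightarrow> E (\<lambda>_. 0)) at_top"
  proof (rule tendsto)
    show "\<forall>\<^sub>F t in at_top. continuous_on {0..b} (\<lambda>x. 1 * ln (x + t) + (- ln t) * 1)"
      using eventually_gt_at_top[of 0] by eventually_elim (intro continuous_intros, auto)
    show "uniform_limit {0..b} (\<lambda>t x. 1 * ln (x + t) + (- ln t) * 1) (\<lambda>_. 0) at_top"
    proof (rule uniform_limitI)
      fix e :: real assume e: "e > 0"
      show "\<forall>\<^sub>F t in at_top. \<forall>x\<in>{0..b}. dist (1 * ln (x + t) + (- ln t) * 1) 0 < e"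
        using eventually_gt_at_top[of 0] eventually_gt_at_top[of "b / e"]
      proof eventually_elim
        case (elim t)
        show ?case
        proof
          fix x assume x: "x \<in> {0..b}"
          have "ln (x + t) - ln t = ln (1 + x / t)"
            using elim x ln_div[of "x + t" t] by (simp add: add_divide_distrib add.commute)
          moreover have "0 \<le> ln (1 + x / t)" "ln (1 + x / t) \<le> x / t"
            using elim x by (auto intro!: ln_add_one_self_le_self)
          moreover have "x / t \<le> b / t" using x elim by (intro divide_right_mono) auto
          moreover have "b / t < e" using elim e by (simp add: field_simps)
          ultimately show "dist (1 * ln (x + t) + (- ln t) * 1) 0 < e"
            by (simp add: dist_real_def)
        qed
      qed
    qed
  qed auto
  moreover have "E (\<lambda>_. 0) = 0" using linear[of "\<lambda>_. 1" "\<lambda>_. 1" 0 0] by (simp add: one)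
  moreover have "\<forall>\<^sub>F t in at_top. E (\<lambda>x. 1 * ln (x + t) + (- ln t) * 1) = E (\<lambda>x. ln (x + t)) - ln t"
    using eventually_gt_at_top[of 0]
    by eventually_elim (subst linear, auto intro!: cont simp: one)
  ultimately show ?thesis using Lim_transform_eventually by fastforce
qed

text \<open>The subtracted terms are the affine expansion of \<open>eta\<close> at \<open>t\<close>;
  the remainder \<open>(x + t) * ln (1 + x / t) - x\<close> lies between \<open>0\<close> and
  \<open>x\<^sup>2 / t\<close>.\<close>

lemma eta_at_top:
  "((\<lambda>t. E (\<lambda>x. eta (x + t)) - t * ln t - (ln t + 1) * E (\<lambda>x. x)) \<longlongrightarrow> 0) at_top"
proof -
  define r where "r t x = eta (x + t) - t * ln t - (ln t + 1) * x" for t x :: real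
  have cont: "continuous_on {0..b} (\<lambda>x. eta (x + t))" if "t > 0" for t
  proof -
    have "continuous_on {0..b} (\<lambda>x. (x + t) * ln (x + t))"
      using that by (intro continuous_intros) auto
    then show ?thesis by (rule continuous_on_eq) (use that in \<open>auto simp: eta_def\<close>)
  qed
  have contr: "continuous_on {0..b} (r t)" if "t > 0" for t
    unfolding r_def using cont[OF that] by (intro continuous_intros)
  have "((\<lambda>t. E (r t)) \<longlongrightarrow> E (\<lambda>_. 0)) at_top"
  proof (rule tendsto)
    show "\<forall>\<^sub>F t in at_top. continuous_on {0..b} (r t)"
      using eventually_gt_at_top[of 0] by eventually_elim (rule contr)
    show "uniform_limit {0..b} r (\<lambda>_. 0) at_top"
    proof (rule uniform_limitI)
      fix e :: real assume e: "e > 0"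
      show "\<forall>\<^sub>F t in at_top. \<forall>x\<in>{0..b}. dist (r t x) 0 < e"
        using eventually_gt_at_top[of 0] eventually_gt_at_top[of "b\<^sup>2 / e"]
      proof eventually_elim
        case (elim t)
        show ?case
        proof
          fix x assume x: "x \<in> {0..b}"
          define u where "u = x / t"
          have u: "0 \<le> u" "x = u * t" using x elim by (auto simp: u_def)
          have "x + t = t * (1 + u)" using u by (simp add: algebra_simps)
          then have "ln (x + t) = ln t + ln (1 + u)" using u elim by (simp add: ln_mult)
          then have r: "r t x = (x + t) * ln (1 + u) - x"
            using x elim by (simp add: r_def eta_def algebra_simps)
          \<comment> \<open>The lower bound uses \<open>ln y \<le> y - 1\<close> at
            \<open>y = inverse (1 + u)\<close>; the upper bound further down uses
            \<open>ln (1 + u) \<le> u\<close>.\<close>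
          have "- ln (1 + u) \<le> inverse (1 + u) - 1"
            using u ln_le_minus_one[of "inverse (1 + u)"] by (simp add: ln_inverse)
          then have "(x + t) * (1 - inverse (1 + u)) \<le> (x + t) * ln (1 + u)"
            using x elim by (intro mult_left_mono) auto
          also have "(x + t) * (1 - inverse (1 + u)) = x"
            using u elim by (simp add: field_simps)
          finally have "0 \<le> r t x" by (simp add: r)
          have "(x + t) * ln (1 + u) \<le> (x + t) * u"
            using x elim u by (intro mult_left_mono ln_add_one_self_le_self) auto
          then have "r t x \<le> x\<^sup>2 / t"
            using elim by (simp add: r u_def field_simps power2_eq_square)
          also have "\<dots> \<le> b\<^sup>2 / t" using x elim by (intro divide_right_mono power_mono) auto
          also have "\<dots> < e" using elim e by (simp add: field_simps)
          finally show "dist (r t x) 0 < e" using \<open>0 \<le> r t x\<close> by (simp add: dist_real_def)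
        qed
      qed
    qed
  qed auto
  moreover have "E (\<lambda>_. 0) = 0" using linear[of "\<lambda>_. 1" "\<lambda>_. 1" 0 0] by (simp add: one)
  moreover have "E (r t) = E (\<lambda>x. eta (x + t)) - t * ln t - (ln t + 1) * E (\<lambda>x. x)" if "t > 0" for t
  proof -
    have "E (\<lambda>x. 1 * (1 * eta (x + t) + (- t * ln t) * 1) + (- (ln t + 1)) * x) =
        1 * (1 * E (\<lambda>x. eta (x + t)) + (- t * ln t) * 1) + (- (ln t + 1)) * E (\<lambda>x. x)"
      using cont[OF that] by (subst linear, auto intro!: continuous_intros)
        (subst linear[of "\<lambda>x. eta (x + t)" "\<lambda>_. 1" 1 "- t * ln t", simplified], auto simp: one)
    moreover have "r t = (\<lambda>x. 1 * (1 * eta (x + t) + (- t * ln t) * 1) + (- (ln t + 1)) * x)"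
      by (simp add: fun_eq_iff r_def algebra_simps)
    ultimately show ?thesis by (simp add: algebra_simps)
  qed
  then have "\<forall>\<^sub>F t in at_top. E (r t) = E (\<lambda>x. eta (x + t)) - t * ln t - (ln t + 1) * E (\<lambda>x. x)"
    by (intro eventually_mono[OF eventually_gt_at_top[of 0]]) auto
  ultimately show ?thesis using Lim_transform_eventually by fastforce
qed

lemma eta_at_0: "((\<lambda>t. E (\<lambda>x. eta (x + t))) \<longlongrightarrow> E eta) (at_right 0)"
proof (rule tendsto)
  have cont: "continuous_on {0..b} (\<lambda>x. eta (x + t))" if "t \<ge> 0" for t
    by (rule continuous_on_compose2[OF continuous_on_eta])
      (use that in \<open>auto intro!: continuous_intros\<close>)
  show "continuous_on {0..b} eta" using cont[of 0] by simp
  show "\<forall>\<^sub>F t in at_right 0. continuous_on {0..b} (\<lambda>x. eta (x + t))"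
    using eventually_at_right_less[of 0] by eventually_elim (simp add: cont)
  \<comment> \<open>The extra unit of length keeps \<open>x + t\<close> inside for
    \<open>t < 1\<close>.\<close>
  have uc: "uniformly_continuous_on {0..b + 1} eta"
    by (intro compact_uniformly_continuous continuous_on_subset[OF continuous_on_eta]) auto
  show "uniform_limit {0..b} (\<lambda>t x. eta (x + t)) eta (at_right 0)"
  proof (rule uniform_limitI)
    fix e :: real assume "e > 0"
    then obtain \<delta> where \<delta>: "\<delta> > 0" "\<And>x y. x \<in> {0..b + 1} \<Longrightarrow> y \<in> {0..b + 1} \<Longrightarrow>
        dist y x < \<delta> \<Longrightarrow> dist (eta y) (eta x) < e"
      using uc unfolding uniformly_continuous_on_def by meson
    have "\<forall>\<^sub>F t in at_right 0. t \<in> {0<..<min \<delta> 1}"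
      using \<delta>(1) by (intro eventually_at_right_real) auto
    then show "\<forall>\<^sub>F t in at_right 0. \<forall>x\<in>{0..b}. dist (eta (x + t)) (eta x) < e"
    proof eventually_elim
      case (elim t)
      show ?case
      proof
        fix x assume "x \<in> {0..b}"
        then show "dist (eta (x + t)) (eta x) < e"
          using elim by (intro \<delta>(2)) (auto simp: dist_real_def)
      qed
    qed
  qed
qed

end

section \<open>States on bicommutants\<close>

lemma commutant_closure:
  "id_blinfun \<in> commutant N"
  "S \<in> commutant N \<Longrightarrow> T \<in> commutant N \<Longrightarrow> S + T \<in> commutant N"
  "S \<in> commutant N \<Longrightarrow> T \<in> commutant N \<Longrightarrow> S - T \<in> commutant N"
  "S \<in> commutant N \<Longrightarrow> T \<in> commutant N \<Longrightarrow> S o\<^sub>L T \<in> commutant N"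
  "S \<in> commutant N \<Longrightarrow> r *\<^sub>R S \<in> commutant N"
  by (auto simp: commutant_def bounded_ops_closure op_comp.add_left op_comp.add_right
      op_comp.diff_left op_comp.diff_right op_comp.scaleR_left op_comp.scaleR_right)
    (metis blinfun_compose_assoc)

lemma commutant_limit:
  assumes S: "\<And>n. S n \<in> commutant N" and lim: "S \<longlonglongrightarrow> (T :: 'h::chilbert_space \<Rightarrow>\<^sub>L 'h)"
  shows "T \<in> commutant N"
proof -
  have "T o\<^sub>L U = U o\<^sub>L T" if "U \<in> N" for U
  proof (rule LIMSEQ_unique)
    show "(\<lambda>n. S n o\<^sub>L U) \<longlonglongrightarrow> (T o\<^sub>L U)"
      by (intro op_comp.tendsto lim tendsto_const)
    have "S n o\<^sub>L U = U o\<^sub>L S n" for n using S that by (simp add: commutant_def)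
    then show "(\<lambda>n. S n o\<^sub>L U) \<longlonglongrightarrow> (U o\<^sub>L T)"
      by (simp add: op_comp.tendsto lim)
  qed
  moreover have "T \<in> bounded_ops"
    using S by (intro bounded_ops_limit[OF _ lim]) (simp add: commutant_def)
  ultimately show ?thesis by (simp add: commutant_def)
qed

lemma poly_op_in_commutant: "T \<in> commutant N \<Longrightarrow> poly_op p T \<in> commutant N"
proof (induction p)
  case 0
  show ?case using commutant_closure(5)[OF commutant_closure(1), of 0] by simp
next
  case (pCons a p)
  then show ?case unfolding poly_op_pCons by (intro commutant_closure)
qed

text \<open>Commutants are norm-closed algebras. Taking \<open>N\<close> to be the commutant of
  \<open>M\<close> shows that \<open>M\<close> is stable under the calculus.\<close>

lemma (in spectral_bound) cfc_in_commutant: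
  assumes "T \<in> commutant N" and f: "continuous_on K f"
  shows "cfc f T \<in> commutant N"
proof -
  obtain p where "(\<lambda>n. poly_op (p n) T) \<longlonglongrightarrow> cfc f T" using cfc_approx[OF f] .
  then show ?thesis by (rule commutant_limit[OF poly_op_in_commutant[OF assms(1)]])
qed

text \<open>Expand the nonnegative form of \<open>X\<close> at \<open>u - w\<close>. Equality holds
  at \<open>u = w\<close>, which makes this the variational formula for the inverse.\<close>

lemma positive_quadratic_lower:
  assumes X: "hermitian X" "\<And>x. 0 \<le> X x \<bullet> x" and w: "X w = v"
  shows "2 * (u \<bullet> v) - X u \<bullet> u \<le> w \<bullet> v"
proof -
  have "0 \<le> X (u - w) \<bullet> (u - w)" by (rule X(2))
  also have "\<dots> = X u \<bullet> u - 2 * (u \<bullet> v) + w \<bullet> v"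
    using hermitian_inner[OF X(1), of u w] w
    by (simp add: blinfun.bilinear_simps inner_diff inner_commute[of v])
  finally show ?thesis by simp
qed

text \<open>Operator convexity of the inverse, from
  \<open>X\<^sup>-\<^sup>1 v \<bullet> v = sup\<^sub>u (2 (u \<bullet> v) - X u \<bullet> u)\<close>.\<close>

lemma inverse_midpoint_convex:
  assumes X: "hermitian X" "\<And>x. 0 \<le> X x \<bullet> x" "X o\<^sub>L X' = id_blinfun"
    and Y: "hermitian Y" "\<And>x. 0 \<le> Y x \<bullet> x" "Y o\<^sub>L Y' = id_blinfun"
    and Z: "((1/2) *\<^sub>R (X + Y)) o\<^sub>L Z' = id_blinfun"
  shows "Z' v \<bullet> v \<le> (X' v \<bullet> v + Y' v \<bullet> v) / 2"
proof -
  have 1: "X (X' v) = v" "Y (Y' v) = v" "((1/2) *\<^sub>R (X + Y)) (Z' v) = v"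
    using X(3) Y(3) Z by (metis blinfun_apply_blinfun_compose blinfun_apply_id_blinfun)+
  \<comment> \<open>The optimal test vector \<open>Z' v\<close> for the midpoint is used for both
    \<open>X\<close> and \<open>Y\<close>; their quadratic terms then add up to twice that of the
    midpoint.\<close>
  have "X (Z' v) \<bullet> Z' v + Y (Z' v) \<bullet> Z' v = 2 * (((1/2) *\<^sub>R (X + Y)) (Z' v) \<bullet> Z' v)"
    by (simp add: blinfun.bilinear_simps inner_add_left)
  also have "\<dots> = 2 * (Z' v \<bullet> v)" by (simp only: 1 inner_commute)
  finally show ?thesis
    using positive_quadratic_lower[OF X(1,2) 1(1), of "Z' v"]
      positive_quadratic_lower[OF Y(1,2) 1(2), of "Z' v"] by simp
qed

section \<open>The state on the functional calculus\<close>

locale operator_state =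
  fixes M :: "('h::chilbert_space \<Rightarrow>\<^sub>L 'h) set" and \<tau> :: "('h \<Rightarrow>\<^sub>L 'h) \<Rightarrow> complex"
  assumes bicommutant: "commutant (commutant M) = M" and state: "state_on M \<tau>"
begin

lemmas M_closure = commutant_closure[where N = "commutant M", unfolded bicommutant]

lemma \<tau>_add: "S \<in> M \<Longrightarrow> T \<in> M \<Longrightarrow> \<tau> (S + T) = \<tau> S + \<tau> T"
  using state by (simp add: state_on_def)

lemma \<tau>_scaleR: "S \<in> M \<Longrightarrow> \<tau> (r *\<^sub>R S) = complex_of_real r * \<tau> S"
  using state unfolding state_on_def by (metis scaleC_op_of_real)

lemma \<tau>_id: "\<tau> id_blinfun = 1"
  using state by (simp add: state_on_def)

lemma \<tau>_nonneg:
  assumes "T \<in> M" "hermitian T" "\<And>x. 0 \<le> T x \<bullet> x"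
  shows "0 \<le> Re (\<tau> T)" "Im (\<tau> T) = 0"
proof -
  have "T \<in> pos_cone M" using assms by (simp add: pos_cone_def positive_op_iff)
  then have "\<tau> T \<in> \<real>\<^sub>\<ge>\<^sub>0" using state by (simp add: state_on_def)
  then show "0 \<le> Re (\<tau> T)" "Im (\<tau> T) = 0" by (auto simp: complex_nonneg_Reals_iff)
qed

text \<open>Both \<open>norm T + T\<close> and \<open>norm T - T\<close> are positive, so the state
  is real and nonnegative on them.\<close>

lemma \<tau>_hermitian:
  assumes T: "T \<in> M" "hermitian T"
  shows "Im (\<tau> T) = 0" "\<bar>Re (\<tau> T)\<bar> \<le> norm T"
proof -
  have *: "0 \<le> norm T + s * Re (\<tau> T) \<and> s * Im (\<tau> T) = 0" if s: "\<bar>s\<bar> = 1" for s :: real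
  proof -
    let ?U = "norm T *\<^sub>R id_blinfun + s *\<^sub>R T"
    have U: "?U \<in> M" "hermitian ?U" using T by (auto intro!: M_closure hermitian_intros)
    have "0 \<le> ?U x \<bullet> x" for x
    proof -
      have "\<bar>s * (T x \<bullet> x)\<bar> \<le> norm T * norm x * norm x"
        using order_trans[OF Cauchy_Schwarz_ineq2 mult_right_mono[OF norm_blinfun norm_ge_zero], of T x x]
        by (simp add: abs_mult s)
      then show ?thesis
        by (simp add: blinfun.bilinear_simps inner_add_left power2_norm_eq_inner[symmetric]
            power2_eq_square mult.assoc abs_le_iff)
    qed
    from \<tau>_nonneg[OF U this] show ?thesis
      using T by (simp add: \<tau>_add \<tau>_scaleR \<tau>_id M_closure)
  qed
  show "Im (\<tau> T) = 0" "\<bar>Re (\<tau> T)\<bar> \<le> norm T" using *[of 1] *[of "- 1"] by auto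
qed

text \<open>The real part is taken to obtain a real functional; \<open>\<tau>_cfc\<close> shows that
  nothing is lost.\<close>

definition tr_cfc :: "('h \<Rightarrow>\<^sub>L 'h) \<Rightarrow> (real \<Rightarrow> real) \<Rightarrow> real" where
  "tr_cfc T f = Re (\<tau> (cfc f T))"

lemma \<tau>_cfc:
  assumes "spectral_bound T K" "T \<in> M" "continuous_on K f"
  shows "\<tau> (cfc f T) = complex_of_real (tr_cfc T f)"
proof -
  interpret spectral_bound T K by fact
  have "cfc f T \<in> M" using cfc_in_commutant[where N = "commutant M"] assms bicommutant by simp
  then show ?thesis
    using \<tau>_hermitian(1) hermitian_cfc[OF assms(3)] by (simp add: tr_cfc_def complex_eq_iff)
qed

lemma bounded_functional_tr_cfc:
  assumes "spectral_bound T {0..b}" "T \<in> M"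
  shows "bounded_functional (tr_cfc T) b"
proof -
  interpret spectral_bound T "{0..b}" by fact
  have inM: "cfc f T \<in> M" if "continuous_on {0..b} f" for f
    using cfc_in_commutant[where N = "commutant M"] assms bicommutant that by simp
  show ?thesis
  proof
    show "tr_cfc T (\<lambda>x. a * f x + c * g x) = a * tr_cfc T f + c * tr_cfc T g"
      if "continuous_on {0..b} f" "continuous_on {0..b} g" for f g a c
      using that by (simp add: tr_cfc_def cfc_linear \<tau>_add \<tau>_scaleR M_closure inM)
    show "\<bar>tr_cfc T f\<bar> \<le> c"
      if f: "continuous_on {0..b} f" and c: "0 \<le> c" "\<And>x. x \<in> {0..b} \<Longrightarrow> \<bar>f x\<bar> \<le> c" for f c
      using \<tau>_hermitian(2)[OF inM[OF f] hermitian_cfc[OF f]] norm_cfc_le[OF f c]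
      by (simp add: tr_cfc_def)
    have "poly [:1:] = (\<lambda>_. 1 :: real)" by (simp add: fun_eq_iff)
    then have "cfc (\<lambda>_. 1) T = id_blinfun"
      using cfc_poly[of "[:1:]"] by (simp add: poly_op_pCons)
    then show "tr_cfc T (\<lambda>_. 1) = 1" by (simp add: tr_cfc_def \<tau>_id)
  qed
qed

lemma pos_cone_spectral_bound:
  assumes "C \<in> pos_cone M"
  shows "spectral_bound C {0..norm C}"
proof
  have C: "hermitian C" "\<And>x. 0 \<le> C x \<bullet> x"
    using assms by (auto simp: pos_cone_def positive_op_iff)
  show "hermitian C" by fact
  have "C x \<bullet> x \<le> norm C * (norm x)\<^sup>2" for x
    using order_trans[OF norm_cauchy_schwarz mult_right_mono[OF norm_blinfun norm_ge_zero], of C x x]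
    by (simp add: power2_eq_square)
  then show "real_spectrum C \<subseteq> {0..norm C}"
    using C by (intro real_spectrum_subset) auto
qed simp

lemma cfc_ln_shift:
  assumes C: "C \<in> pos_cone M" and t: "t > 0"
  shows "\<tau> (cfc ln (C + t *\<^sub>R id_blinfun)) = complex_of_real (tr_cfc C (\<lambda>x. ln (x + t)))"
proof -
  have "cfc ln (C + t *\<^sub>R id_blinfun) = cfc (\<lambda>x. ln (x + t)) C"
    using t by (intro cfc_shift[OF pos_cone_spectral_bound[OF C]] continuous_intros) auto
  then show ?thesis
    using C t \<tau>_cfc[OF pos_cone_spectral_bound[OF C], of "\<lambda>x. ln (x + t)"]
    by (simp add: pos_cone_def continuous_intros)
qed

text \<open>Identifies the calculus of \<open>1 / (x + t)\<close> with the inverse of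
  \<open>C + t\<close>, through multiplicativity of the calculus.\<close>

lemma cfc_inverse_shift:
  assumes C: "C \<in> pos_cone M" and t: "t > 0"
  defines "R \<equiv> cfc (\<lambda>x. inverse (x + t)) C"
  shows "R \<in> M" "hermitian R" "(C + t *\<^sub>R id_blinfun) o\<^sub>L R = id_blinfun"
proof -
  interpret spectral_bound C "{0..norm C}" using C by (rule pos_cone_spectral_bound)
  have CM: "C \<in> M" using C by (simp add: pos_cone_def)
  have cont: "continuous_on {0..norm C} (\<lambda>x. inverse (x + t))"
    using t by (intro continuous_intros) auto
  show "R \<in> M" using cfc_in_commutant[where N = "commutant M"] CM bicommutant cont by (simp add: R_def)
  show "hermitian R" unfolding R_def using cont by (rule hermitian_cfc)
  have "(C + t *\<^sub>R id_blinfun) o\<^sub>L R = cfc (\<lambda>x. poly [:t, 1:] x * inverse (x + t)) C"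
    unfolding R_def
    by (subst cfc_mult[OF _ cont])
      (auto intro!: continuous_intros simp: cfc_poly poly_op_linear add.commute)
  \<comment> \<open>The product equals \<open>1\<close> on the interval but not at
    \<open>x = - t\<close>, where \<open>inverse 0 = 0\<close>. So the constant polynomials
    \<open>1\<close> serve as approximants on the interval instead of a rewriting of the
    function.\<close>
  also have "\<dots> = id_blinfun"
  proof (rule cfc_eqI)
    show "continuous_on {0..norm C} (\<lambda>x. poly [:t, 1:] x * inverse (x + t))"
      by (intro continuous_on_mult continuous_on_poly cont continuous_on_id)
    have "poly [:t, 1:] x * inverse (x + t) = 1" if "x \<in> {0..norm C}" for x
      using that t by (simp add: field_simps)
    then show "uniform_limit {0..norm C} (\<lambda>n. poly [:1:]) (\<lambda>x. poly [:t, 1:] x * inverse (x + t)) sequentially"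
      by (simp add: uniform_limit_iff del: poly_pCons) simp
    show "(\<lambda>n. poly_op [:1:] C) \<longlonglongrightarrow> id_blinfun" by (simp add: poly_op_pCons)
  qed
  finally show "(C + t *\<^sub>R id_blinfun) o\<^sub>L R = id_blinfun" .
qed

text \<open>The operator inequality for the inverses of \<open>A + t\<close>, \<open>B + t\<close>
  and their midpoint, to which positivity of the state is applied.\<close>

lemma tr_inverse_midpoint_convex:
  assumes A: "A \<in> pos_cone M" and B: "B \<in> pos_cone M" and t: "t > 0"
    and Z: "(1/2) *\<^sub>R (A + B) \<in> pos_cone M"
  shows "tr_cfc ((1/2) *\<^sub>R (A + B)) (\<lambda>x. inverse (x + t)) \<le>
    tr_cfc A (\<lambda>x. inverse (x + t)) / 2 + tr_cfc B (\<lambda>x. inverse (x + t)) / 2"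
proof -
  let ?I = "\<lambda>C. cfc (\<lambda>x. inverse (x + t)) C"
  let ?Z = "(1/2) *\<^sub>R (A + B)"
  note IA = cfc_inverse_shift[OF A t] and IB = cfc_inverse_shift[OF B t]
    and IZ = cfc_inverse_shift[OF Z t]
  have shift: "hermitian (C + t *\<^sub>R id_blinfun)" "0 \<le> (C + t *\<^sub>R id_blinfun) x \<bullet> x"
    if "C \<in> pos_cone M" for C x
    using that t
    by (auto intro!: hermitian_intros simp: pos_cone_def positive_op_iff blinfun.bilinear_simps inner_add_left)
  have mid: "?Z + t *\<^sub>R id_blinfun = (1/2) *\<^sub>R ((A + t *\<^sub>R id_blinfun) + (B + t *\<^sub>R id_blinfun))"
    by (simp add: scaleR_add_right flip: scaleR_add_left)
  have "?I ?Z v \<bullet> v \<le> (?I A v \<bullet> v + ?I B v \<bullet> v) / 2" for v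
    by (rule inverse_midpoint_convex[OF shift[OF A] IA(3) shift[OF B] IB(3) IZ(3)[unfolded mid]])
  then have "0 \<le> ((1/2) *\<^sub>R ?I A + (1/2) *\<^sub>R ?I B + (- 1) *\<^sub>R ?I ?Z) v \<bullet> v" for v
    by (simp add: blinfun.bilinear_simps inner_add_left inner_diff_left add_divide_distrib)
  then have "0 \<le> Re (\<tau> ((1/2) *\<^sub>R ?I A + (1/2) *\<^sub>R ?I B + (- 1) *\<^sub>R ?I ?Z))"
    using IA IB IZ by (intro \<tau>_nonneg M_closure hermitian_intros)
  also have "\<tau> ((1/2) *\<^sub>R ?I A + (1/2) *\<^sub>R ?I B + (- 1) *\<^sub>R ?I ?Z) =
      complex_of_real (1/2) * \<tau> (?I A) + complex_of_real (1/2) * \<tau> (?I B) + complex_of_real (- 1) * \<tau> (?I ?Z)"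
    using IA(1) IB(1) IZ(1) by (simp only: \<tau>_add \<tau>_scaleR M_closure)
  finally show ?thesis by (simp add: tr_cfc_def)
qed

end

section \<open>The integral formula\<close>

text \<open>Resolves the definite description: \<open>sqrt h\<close> is the only nonnegative
  root.\<close>

lemma d_tau_square:
  assumes "\<tau> (cfc ln ((1/2) *\<^sub>R (A + B))) - 1/2 * \<tau> (cfc ln A) - 1/2 * \<tau> (cfc ln B) = complex_of_real h"
    and "0 \<le> h"
  shows "(d_tau \<tau> A B)\<^sup>2 = h"
proof -
  have "d_tau \<tau> A B = sqrt h"
    unfolding d_tau_def assms(1) of_real_eq_iff
    by (rule the_equality) (use assms(2) in \<open>auto intro!: real_sqrt_unique[symmetric]\<close>)
  then show ?thesis using assms(2) by simp
qed

theorem proposition8p3: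
  fixes M :: "('h::chilbert_space \<Rightarrow>\<^sub>L 'h) set"
    and \<tau> :: "('h \<Rightarrow>\<^sub>L 'h) \<Rightarrow> complex"
    and A B :: "'h \<Rightarrow>\<^sub>L 'h"
  assumes "finite_von_neumann_algebra M"
    and "state_on M \<tau>" and "tracial_on M \<tau>" and "faithful_on M \<tau>" and "normal_on M \<tau>"
    and "A \<in> pos_cone M" and "B \<in> pos_cone M"
  shows "set_integrable lborel {0<..}
           (\<lambda>t::real. (d_tau \<tau> (A + t *\<^sub>R id_blinfun) (B + t *\<^sub>R id_blinfun))\<^sup>2) \<and>
         J_eta \<tau> A B = complex_of_real
           (LBINT t:{0<..}. (d_tau \<tau> (A + t *\<^sub>R id_blinfun) (B + t *\<^sub>R id_blinfun))\<^sup>2)"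
proof -
  interpret operator_state M \<tau>
    using assms(1,2) by unfold_locales
      (simp_all add: finite_von_neumann_algebra_def von_neumann_algebra_def)
  define Z where "Z = (1/2) *\<^sub>R (A + B)"
  note A = \<open>A \<in> pos_cone M\<close> and B = \<open>B \<in> pos_cone M\<close>
  have AM: "A \<in> M" and BM: "B \<in> M" using A B by (simp_all add: pos_cone_def)
  have ZM: "Z \<in> M" unfolding Z_def using AM BM by (intro M_closure)
  have Z: "Z \<in> pos_cone M"
    using A B ZM unfolding Z_def pos_cone_def positive_op_iff
    by (auto intro!: hermitian_intros simp: blinfun.bilinear_simps inner_add_left)
  note sb = pos_cone_spectral_bound[OF A] pos_cone_spectral_bound[OF B] pos_cone_spectral_bound[OF Z]
  interpret A: bounded_functional "tr_cfc A" "norm A" using sb(1) AM by (rule bounded_functional_tr_cfc)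
  interpret B: bounded_functional "tr_cfc B" "norm B" using sb(2) BM by (rule bounded_functional_tr_cfc)
  interpret Z: bounded_functional "tr_cfc Z" "norm Z" using sb(3) ZM by (rule bounded_functional_tr_cfc)

  \<comment> \<open>The sign is chosen so that the value is nonnegative on the concave functions
    \<open>ln (x + t)\<close>. The coefficients sum to zero, so constants vanish.\<close>
  define jensen where "jensen f = tr_cfc Z f - tr_cfc A f / 2 - tr_cfc B f / 2" for f
  define h where "h t = jensen (\<lambda>x. ln (x + t))" for t
  define F where "F t = jensen (\<lambda>x. eta (x + t))" for t
  have h_deriv: "(h has_real_derivative jensen (\<lambda>x. inverse (x + t))) (at t)" if "t > 0" for t
    unfolding h_def jensen_def
    by (intro DERIV_diff DERIV_cdivide A.ln_derivative B.ln_derivative Z.ln_derivative that)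
  have h_nonneg: "0 \<le> h t" if t: "t > 0" for t
  proof -
    \<comment> \<open>The three copies of \<open>ln t\<close> cancel, which turns the limits of the
      normalized terms into a limit of \<open>h\<close>.\<close>
    have "((\<lambda>t. (tr_cfc Z (\<lambda>x. ln (x + t)) - ln t) - (tr_cfc A (\<lambda>x. ln (x + t)) - ln t) / 2
        - (tr_cfc B (\<lambda>x. ln (x + t)) - ln t) / 2) \<longlongrightarrow> 0 - 0 / 2 - 0 / 2) at_top"
      by (intro tendsto_diff tendsto_divide tendsto_const A.ln_at_top B.ln_at_top Z.ln_at_top) simp_all
    then have lim: "(h \<longlongrightarrow> 0) at_top" by (simp add: h_def[abs_def] jensen_def field_simps)
    \<comment> \<open>A nonincreasing function with limit \<open>0\<close> at infinity is
      nonnegative.\<close>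
    have "h s \<le> h t" if "t \<le> s" for s
    proof (rule DERIV_nonpos_imp_nonincreasing[OF that])
      fix x assume "t \<le> x"
      then have "x > 0" using t by simp
      then show "\<exists>y. (h has_real_derivative y) (at x) \<and> y \<le> 0"
        using h_deriv[of x] tr_inverse_midpoint_convex[OF A B, of x, folded Z_def] Z
        by (intro exI[of _ "jensen (\<lambda>u. inverse (u + x))"]) (simp add: jensen_def)
    qed
    then have "\<forall>\<^sub>F s in at_top. h s \<le> h t"
      unfolding eventually_at_top_linorder by blast
    then show ?thesis using lim by (intro tendsto_upperbound) auto
  qed
  have F_deriv: "(F has_real_derivative h t) (at t)" if "t > 0" for t
  proof -
    have "(F has_real_derivative (tr_cfc Z (\<lambda>x. ln (x + t)) + 1) - (tr_cfc A (\<lambda>x. ln (x + t)) + 1) / 2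
        - (tr_cfc B (\<lambda>x. ln (x + t)) + 1) / 2) (at t)"
      unfolding F_def jensen_def
      by (intro DERIV_diff DERIV_cdivide A.eta_derivative B.eta_derivative Z.eta_derivative that)
    also have "(tr_cfc Z (\<lambda>x. ln (x + t)) + 1) - (tr_cfc A (\<lambda>x. ln (x + t)) + 1) / 2
        - (tr_cfc B (\<lambda>x. ln (x + t)) + 1) / 2 = h t"
      by (simp add: h_def jensen_def field_simps)
    finally show ?thesis .
  qed
  have F_0: "(F \<longlongrightarrow> jensen eta) (at_right 0)"
    unfolding F_def[abs_def] jensen_def
    by (intro tendsto_diff tendsto_divide tendsto_const A.eta_at_0 B.eta_at_0 Z.eta_at_0) simp_all
  have F_inf: "(F \<longlongrightarrow> 0) at_top"
  proof -
    have poly_id: "poly [:0, 1:] = (\<lambda>x. x :: real)" by (simp add: fun_eq_iff)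
    have tr_id: "tr_cfc C (\<lambda>x. x) = Re (\<tau> C)" if "spectral_bound C K" for C K
      using spectral_bound.cfc_poly[OF that, of "[:0, 1:]"] unfolding poly_id
      by (simp add: tr_cfc_def poly_op_linear)
    \<comment> \<open>With equal means the diverging terms \<open>t * ln t\<close> and
      \<open>(ln t + 1) * x\<close> cancel in \<open>jensen\<close>.\<close>
    have mean: "tr_cfc Z (\<lambda>x. x) = tr_cfc A (\<lambda>x. x) / 2 + tr_cfc B (\<lambda>x. x) / 2"
      using AM BM by (simp add: tr_id[OF sb(1)] tr_id[OF sb(2)] tr_id[OF sb(3)])
        (simp add: Z_def \<tau>_scaleR \<tau>_add M_closure del: of_real_divide)
    let ?g = "\<lambda>C t. tr_cfc C (\<lambda>x. eta (x + t)) - t * ln t - (ln t + 1) * tr_cfc C (\<lambda>x. x)"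
    have "((\<lambda>t. ?g Z t - ?g A t / 2 - ?g B t / 2) \<longlongrightarrow> 0 - 0 / 2 - 0 / 2) at_top"
      by (intro tendsto_diff tendsto_divide tendsto_const A.eta_at_top B.eta_at_top Z.eta_at_top) simp_all
    moreover have "?g Z t - ?g A t / 2 - ?g B t / 2 = F t" for t
      unfolding mean F_def jensen_def by (simp add: field_simps)
    ultimately show ?thesis by simp
  qed
  have d: "(d_tau \<tau> (A + t *\<^sub>R id_blinfun) (B + t *\<^sub>R id_blinfun))\<^sup>2 = h t" if t: "t > 0" for t
  proof (rule d_tau_square[OF _ h_nonneg[OF t]])
    have mid: "(1/2) *\<^sub>R ((A + t *\<^sub>R id_blinfun) + (B + t *\<^sub>R id_blinfun)) = Z + t *\<^sub>R id_blinfun"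
      by (simp add: Z_def scaleR_add_right flip: scaleR_add_left)
    show "\<tau> (cfc ln ((1/2) *\<^sub>R ((A + t *\<^sub>R id_blinfun) + (B + t *\<^sub>R id_blinfun))))
        - 1/2 * \<tau> (cfc ln (A + t *\<^sub>R id_blinfun)) - 1/2 * \<tau> (cfc ln (B + t *\<^sub>R id_blinfun))
        = complex_of_real (h t)"
      unfolding mid cfc_ln_shift[OF A t] cfc_ln_shift[OF B t] cfc_ln_shift[OF Z t]
      by (simp add: h_def jensen_def)
  qed
  have J: "J_eta \<tau> A B = complex_of_real (- jensen eta)"
    unfolding J_eta_def Z_def[symmetric]
    using \<tau>_cfc[OF sb(1) AM, of eta] \<tau>_cfc[OF sb(2) BM, of eta] \<tau>_cfc[OF sb(3) ZM, of eta]
      continuous_on_subset[OF continuous_on_eta]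
    by (simp add: jensen_def)
  have ftc: "set_integrable lborel (einterval 0 \<infinity>) h" "(LBINT t=0..\<infinity>. h t) = 0 - jensen eta"
  proof -
    \<comment> \<open>For a nonnegative integrand the improper fundamental theorem yields
      integrability together with the value, from the one-sided limits of \<open>F\<close> at
      \<open>0\<close> and at infinity.\<close>
    note ftc' = interval_integral_FTC_nonneg[of 0 \<infinity> F h "jensen eta" 0]
    have "DERIV F t :> h t" "isCont h t" if "0 < ereal t" for t
      using that F_deriv h_deriv by (auto intro: DERIV_isCont)
    moreover have "AE t in lborel. 0 < ereal t \<longrightarrow> ereal t < \<infinity> \<longrightarrow> 0 \<le> h t"
      using h_nonneg by simp
    moreover have "((F \<circ> real_of_ereal) \<longlongrightarrow> jensen eta) (at_right 0)"
      using F_0 by (simp add: ereal_tendsto_simps1 zero_ereal_def)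
    moreover have "((F \<circ> real_of_ereal) \<longlongrightarrow> 0) (at_left \<infinity>)"
      using F_inf by (simp add: ereal_tendsto_simps1)
    ultimately show "set_integrable lborel (einterval 0 \<infinity>) h" "(LBINT t=0..\<infinity>. h t) = 0 - jensen eta"
      using ftc' by auto
  qed
  have "einterval 0 \<infinity> = {0<..}" by (simp add: zero_ereal_def)
  then have "set_integrable lborel {0<..} h" "(LBINT t:{0<..}. h t) = - jensen eta"
    using ftc by (simp_all add: interval_lebesgue_integral_def)
  \<comment> \<open>Congruence on the open half-line is enough: \<open>d\<close> identifies the
    integrands exactly for \<open>t > 0\<close>.\<close>
  moreover have "set_integrable lborel {0<..} (\<lambda>t. (d_tau \<tau> (A + t *\<^sub>R id_blinfun) (B + t *\<^sub>R id_blinfun))\<^sup>2)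
      \<longleftrightarrow> set_integrable lborel {0<..} h"
    by (rule set_integrable_cong) (simp_all add: d)
  moreover have "(LBINT t:{0<..}. (d_tau \<tau> (A + t *\<^sub>R id_blinfun) (B + t *\<^sub>R id_blinfun))\<^sup>2)
      = (LBINT t:{0<..}. h t)"
    by (rule set_lebesgue_integral_cong) (simp_all add: d)
  ultimately show ?thesis using J by simp
qed

end
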